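(* Let $K$ be an $O$-category, let $\Delta$ be an $\omega$-chain in $K_{\mathrm{Adj}}$, and let $\langle C, c\rangle$ be a colimiting cocone for $\Delta$ in $K_{\mathrm{Adj}}$. Then $\langle C, c\rangle$ is locally determined if and only if it is preserved by every locally continuous functor, i.e. if and only if for every $O$-category $L$ and every locally continuous functor $F : K \to L$, the cocone $\langle FC, (F_{\mathrm{Adj}}\,c_n)_{n\in\mathbb{N}}\rangle$ is a colimiting cocone for the $\omega$-chain $F_{\mathrm{Adj}}\circ\Delta$ in $L_{\mathrm{Adj}}$.
   Context: An $O$-category is a category each of whose hom-sets is equipped with a partial order having least upper bounds of all $\omega$-chains $f_0 \le f_1 \le \cdots$ (a least element is not required), such that composition is monotone and preserves least upper bounds of $\omega$-chains in each argument. A functor $F : K \to L$ between $O$-categories is locally continuous when its action on each hom-set is monotone and preserves least upper bounds of $\omega$-chains. For an $O$-category $K$, an adjoint pair $f : A \to B$ is a pair $f = \langle f^L : A \to B,\ f^R : B \to A\rangle$ of morphisms of $K$ with $f^L \circ f^R \le \mathrm{id}_B$ and $\mathrm{id}_A \le f^R \circ f^L$. The category $K_{\mathrm{Adj}}$ has the objects of $K$ and, as morphisms $A \to B$, the adjoint pairs $A\to B$, with $(g\circ f)^L = g^L\circ f^L$ and $(g \circ f)^R = f^R \circ g^R$. A locally continuous functor $F : K \to L$ induces a functor $F_{\mathrm{Adj}} : K_{\mathrm{Adj}} \to L_{\mathrm{Adj}}$, acting as $F$ on objects and by $F_{\mathrm{Adj}} f = \langle F f^L, F f^R\rangle$ on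 morphisms. An $\omega$-chain of adjoint pairs is a functor $\Delta : (\mathbb{N},\le) \to K_{\mathrm{Adj}}$; write $\Delta_{n\le m} : \Delta_n \to \Delta_m$ for its value at $n \le m$. A cocone $\langle C, c\rangle$ for it consists of an object $C$ and adjoint pairs $c_n : \Delta_n \to C$, $n \in\mathbb{N}$, with $c_m\circ\Delta_{n\le m} = c_n$ in $K_{\mathrm{Adj}}$ for all $n \le m$; it is colimiting when it is a colimit of $\Delta$ in $K_{\mathrm{Adj}}$. The cocone is locally determined when $\bigvee_{n\in\mathbb{N}} c_n^L\circ c_n^R = \mathrm{id}_C$ and, for all $n\in\mathbb{N}$, $\bigvee_{m\ge n} \Delta_{n\le m}^R\circ\Delta_{n\le m}^L = c_n^R\circ c_n^L$ (both least upper bounds are of increasing $\omega$-chains). *)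

theory Defs
  imports Main
begin

section \<open>Categories, functors and colimits\<close>

record ('o, 'm) cat =
  Ob :: "'o set"
  Arr :: "'m set"
  Dom :: "'m \<Rightarrow> 'o"
  Cod :: "'m \<Rightarrow> 'o"
  Ide :: "'o \<Rightarrow> 'm"
  Cmp :: "'m \<Rightarrow> 'm \<Rightarrow> 'm"  (infixl "\<cdot>\<index>" 70)

definition Hom :: "('o, 'm, 'x) cat_scheme \<Rightarrow> 'o \<Rightarrow> 'o \<Rightarrow> 'm set" where
  "Hom C A B = {f \<in> Arr C. Dom C f = A \<and> Cod C f = B}"

locale category =
  fixes C :: "('o, 'm, 'x) cat_scheme" (structure)
  assumes Dom_Ob: "f \<in> Arr C \<Longrightarrow> Dom C f \<in> Ob C"
    and Cod_Ob: "f \<in> Arr C \<Longrightarrow> Cod C f \<in> Ob C"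
    and Ide_Hom: "A \<in> Ob C \<Longrightarrow> Ide C A \<in> Hom C A A"
    and Cmp_Hom: "f \<in> Hom C A B \<Longrightarrow> g \<in> Hom C B D \<Longrightarrow> g \<cdot> f \<in> Hom C A D"
    and Cmp_Ide_left: "f \<in> Hom C A B \<Longrightarrow> Ide C B \<cdot> f = f"
    and Cmp_Ide_right: "f \<in> Hom C A B \<Longrightarrow> f \<cdot> Ide C A = f"
    and Cmp_assoc: "f \<in> Hom C A B \<Longrightarrow> g \<in> Hom C B D \<Longrightarrow> h \<in> Hom C D E \<Longrightarrow>
      (h \<cdot> g) \<cdot> f = h \<cdot> (g \<cdot> f)"

record ('o, 'm, 'p, 'q) func =
  omap :: "'o \<Rightarrow> 'p"
  amap :: "'m \<Rightarrow> 'q"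

definition is_functor ::
    "('o, 'm, 'x) cat_scheme \<Rightarrow> ('p, 'q, 'y) cat_scheme \<Rightarrow> ('o, 'm, 'p, 'q) func \<Rightarrow> bool" where
  "is_functor C D F \<longleftrightarrow> category C \<and> category D
    \<and> (\<forall>A \<in> Ob C. omap F A \<in> Ob D)
    \<and> (\<forall>A \<in> Ob C. \<forall>B \<in> Ob C. \<forall>f \<in> Hom C A B. amap F f \<in> Hom D (omap F A) (omap F B))
    \<and> (\<forall>A \<in> Ob C. amap F (Ide C A) = Ide D (omap F A))
    \<and> (\<forall>f \<in> Arr C. \<forall>g \<in> Arr C. Dom C g = Cod C f \<longrightarrow>
        amap F (g \<cdot>\<^bsub>C\<^esub> f) = amap F g \<cdot>\<^bsub>D\<^esub> amap F f)"

definition func_comp ::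
    "('p, 'q, 's, 't) func \<Rightarrow> ('o, 'm, 'p, 'q) func \<Rightarrow> ('o, 'm, 's, 't) func" where
  "func_comp G F = \<lparr> omap = omap G \<circ> omap F, amap = amap G \<circ> amap F \<rparr>"

definition cocone ::
    "('j, 'k, 'z) cat_scheme \<Rightarrow> ('o, 'm, 'x) cat_scheme \<Rightarrow> ('j, 'k, 'o, 'm) func
      \<Rightarrow> 'o \<Rightarrow> ('j \<Rightarrow> 'm) \<Rightarrow> bool" where
  "cocone J C D X c \<longleftrightarrow> X \<in> Ob C
    \<and> (\<forall>j \<in> Ob J. c j \<in> Hom C (omap D j) X)
    \<and> (\<forall>u \<in> Arr J. c (Cod J u) \<cdot>\<^bsub>C\<^esub> amap D u = c (Dom J u))"

definition colimiting ::
    "('j, 'k, 'z) cat_scheme \<Rightarrow> ('o, 'm, 'x) cat_scheme \<Rightarrow> ('j, 'k, 'o, 'm) func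
      \<Rightarrow> 'o \<Rightarrow> ('j \<Rightarrow> 'm) \<Rightarrow> bool" where
  "colimiting J C D X c \<longleftrightarrow> cocone J C D X c
    \<and> (\<forall>Y d. cocone J C D Y d \<longrightarrow>
        (\<exists>!h. h \<in> Hom C X Y \<and> (\<forall>j \<in> Ob J. h \<cdot>\<^bsub>C\<^esub> c j = d j)))"

text \<open>The poset of natural numbers as a category: the pair \<open>(n, m)\<close> is the arrow \<open>n \<le> m\<close>.\<close>

definition nat_cat :: "(nat, nat \<times> nat) cat" where
  "nat_cat = \<lparr> Ob = UNIV, Arr = {(n, m). n \<le> m}, Dom = fst, Cod = snd,
     Ide = (\<lambda>n. (n, n)), Cmp = (\<lambda>g f. (fst f, snd g)) \<rparr>"

section \<open>O-categories and locally continuous functors\<close>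

text \<open>\<open>f \<sqsubseteq> g\<close> is meaningful only for parallel arrows \<open>f\<close> and \<open>g\<close>.\<close>

record ('o, 'm) ocat = "('o, 'm) cat" +
  Le :: "'m \<Rightarrow> 'm \<Rightarrow> bool"  (infix "\<sqsubseteq>\<index>" 50)

definition omega_chain_in :: "('o, 'm, 'x) ocat_scheme \<Rightarrow> 'o \<Rightarrow> 'o \<Rightarrow> (nat \<Rightarrow> 'm) \<Rightarrow> bool" where
  "omega_chain_in K A B f \<longleftrightarrow> (\<forall>n. f n \<in> Hom K A B) \<and> (\<forall>n. f n \<sqsubseteq>\<^bsub>K\<^esub> f (Suc n))"

definition is_lub :: "('o, 'm, 'x) ocat_scheme \<Rightarrow> 'o \<Rightarrow> 'o \<Rightarrow> 'm set \<Rightarrow> 'm \<Rightarrow> bool" where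
  "is_lub K A B S x \<longleftrightarrow> x \<in> Hom K A B \<and> (\<forall>f \<in> S. f \<sqsubseteq>\<^bsub>K\<^esub> x)
    \<and> (\<forall>y \<in> Hom K A B. (\<forall>f \<in> S. f \<sqsubseteq>\<^bsub>K\<^esub> y) \<longrightarrow> x \<sqsubseteq>\<^bsub>K\<^esub> y)"

locale O_category = category K for K :: "('o, 'm, 'x) ocat_scheme" (structure) +
  assumes Le_refl: "reflp_on (Hom K A B) (\<sqsubseteq>)"
    and Le_trans: "transp_on (Hom K A B) (\<sqsubseteq>)"
    and Le_antisym: "antisymp_on (Hom K A B) (\<sqsubseteq>)"
    and lub_exists: "omega_chain_in K A B fs \<Longrightarrow> \<exists>f. is_lub K A B (range fs) f"
    and Cmp_mono_left: "g \<in> Hom K B C \<Longrightarrow> g' \<in> Hom K B C \<Longrightarrow> f \<in> Hom K A B \<Longrightarrow>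
      g \<sqsubseteq> g' \<Longrightarrow> g \<cdot> f \<sqsubseteq> g' \<cdot> f"
    and Cmp_mono_right: "g \<in> Hom K B C \<Longrightarrow> f \<in> Hom K A B \<Longrightarrow> f' \<in> Hom K A B \<Longrightarrow>
      f \<sqsubseteq> f' \<Longrightarrow> g \<cdot> f \<sqsubseteq> g \<cdot> f'"
    and Cmp_lub_left: "omega_chain_in K B C gs \<Longrightarrow> is_lub K B C (range gs) g \<Longrightarrow> f \<in> Hom K A B \<Longrightarrow>
      is_lub K A C (range (\<lambda>n. gs n \<cdot> f)) (g \<cdot> f)"
    and Cmp_lub_right: "g \<in> Hom K B C \<Longrightarrow> omega_chain_in K A B fs \<Longrightarrow> is_lub K A B (range fs) f \<Longrightarrow>
      is_lub K A C (range (\<lambda>n. g \<cdot> fs n)) (g \<cdot> f)"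

definition locally_continuous ::
    "('o, 'm, 'x) ocat_scheme \<Rightarrow> ('p, 'q, 'y) ocat_scheme \<Rightarrow> ('o, 'm, 'p, 'q) func \<Rightarrow> bool" where
  "locally_continuous K L F \<longleftrightarrow> is_functor K L F
    \<and> (\<forall>A \<in> Ob K. \<forall>B \<in> Ob K.
        (\<forall>f \<in> Hom K A B. \<forall>g \<in> Hom K A B. f \<sqsubseteq>\<^bsub>K\<^esub> g \<longrightarrow> amap F f \<sqsubseteq>\<^bsub>L\<^esub> amap F g)
      \<and> (\<forall>fs f. omega_chain_in K A B fs \<and> is_lub K A B (range fs) f \<longrightarrow>
          is_lub L (omap F A) (omap F B) (range (\<lambda>n. amap F (fs n))) (amap F f)))"

section \<open>Adjoint pairs\<close>

text \<open>An adjoint pair \<open>f\<close> is represented as \<open>(f\<^sup>L, f\<^sup>R)\<close>.\<close>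

definition Adj :: "('o, 'm, 'x) ocat_scheme \<Rightarrow> ('o, 'm \<times> 'm) cat" where
  "Adj K = \<lparr> Ob = Ob K,
     Arr = {(l, r). \<exists>A \<in> Ob K. \<exists>B \<in> Ob K. l \<in> Hom K A B \<and> r \<in> Hom K B A
       \<and> l \<cdot>\<^bsub>K\<^esub> r \<sqsubseteq>\<^bsub>K\<^esub> Ide K B \<and> Ide K A \<sqsubseteq>\<^bsub>K\<^esub> r \<cdot>\<^bsub>K\<^esub> l},
     Dom = (\<lambda>f. Dom K (fst f)),
     Cod = (\<lambda>f. Cod K (fst f)),
     Ide = (\<lambda>A. (Ide K A, Ide K A)),
     Cmp = (\<lambda>g f. (fst g \<cdot>\<^bsub>K\<^esub> fst f, snd f \<cdot>\<^bsub>K\<^esub> snd g)) \<rparr>"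

definition Adj_func :: "('o, 'm, 'p, 'q) func \<Rightarrow> ('o, 'm \<times> 'm, 'p, 'q \<times> 'q) func" where
  "Adj_func F = \<lparr> omap = omap F, amap = (\<lambda>f. (amap F (fst f), amap F (snd f))) \<rparr>"

definition locally_determined ::
    "('o, 'm, 'x) ocat_scheme \<Rightarrow> (nat, nat \<times> nat, 'o, 'm \<times> 'm) func
      \<Rightarrow> 'o \<Rightarrow> (nat \<Rightarrow> 'm \<times> 'm) \<Rightarrow> bool" where
  "locally_determined K \<Delta> C c \<longleftrightarrow>
      is_lub K C C {fst (c n) \<cdot>\<^bsub>K\<^esub> snd (c n) | n. True} (Ide K C)
    \<and> (\<forall>n. is_lub K (omap \<Delta> n) (omap \<Delta> n)
          {snd (amap \<Delta> (n, m)) \<cdot>\<^bsub>K\<^esub> fst (amap \<Delta> (n, m)) | m. m \<ge> n}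
          (snd (c n) \<cdot>\<^bsub>K\<^esub> fst (c n)))"

definition preserves_colimit ::
    "('o, 'm, 'p, 'q) func \<Rightarrow> ('p, 'q, 'y) ocat_scheme \<Rightarrow> (nat, nat \<times> nat, 'o, 'm \<times> 'm) func
      \<Rightarrow> 'o \<Rightarrow> (nat \<Rightarrow> 'm \<times> 'm) \<Rightarrow> bool" where
  "preserves_colimit F L \<Delta> C c \<longleftrightarrow>
    colimiting nat_cat (Adj L) (func_comp (Adj_func F) \<Delta>) (omap F C) (\<lambda>n. amap (Adj_func F) (c n))"

text \<open>
  A quantifier over ``every O-category'' inside a formula has to fix the types of objects and
  arrows, so that ``P iff Q(L) for every O-category L'' is stated as: P implies Q(L) for L over
  arbitrary types (type variables of the theorem), and Q(L) for all L over one pair of types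
  that is large enough implies P. For an O-category with arrows of type \<open>'m\<close>, the two types
  below with \<open>'a\<close> instantiated to \<open>nat \<Rightarrow> 'm\<close> are large enough: they hold every O-category
  whose objects are posets carried by subsets of \<open>'a\<close> (given by carrier and order) and whose
  arrows are functions between them (given by source, target and underlying function), in
  particular posets of sequences of arrows.
\<close>

type_synonym 'a poset_ob = "'a set \<times> ('a \<Rightarrow> 'a \<Rightarrow> bool)"
type_synonym 'a poset_arr = "'a poset_ob \<times> 'a poset_ob \<times> ('a \<Rightarrow> 'a)"

section \<open>Well-formedness of the constructions\<close>

lemma category_nat_cat: "category nat_cat"
  by unfold_locales (auto simp: nat_cat_def Hom_def)

lemma Hom_Adj:
  assumes "category K"
  shows "Hom (Adj K) A B = {(l, r). l \<in> Hom K A B \<and> r \<in> Hom K B A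
     \<and> l \<cdot>\<^bsub>K\<^esub> r \<sqsubseteq>\<^bsub>K\<^esub> Ide K B \<and> Ide K A \<sqsubseteq>\<^bsub>K\<^esub> r \<cdot>\<^bsub>K\<^esub> l}"
  using category.Dom_Ob[OF assms] category.Cod_Ob[OF assms]
  by (fastforce simp: Adj_def Hom_def)

context O_category
begin

lemma Adj_Cmp_Hom:
  assumes f: "f \<in> Hom (Adj K) A B" and g: "g \<in> Hom (Adj K) B D"
  shows "g \<cdot>\<^bsub>Adj K\<^esub> f \<in> Hom (Adj K) A D"
proof -
  obtain fl fr gl gr where [simp]: "f = (fl, fr)" "g = (gl, gr)" by (cases f, cases g) auto
  have f': "fl \<in> Hom K A B" "fr \<in> Hom K B A" "fl \<cdot> fr \<sqsubseteq> Ide K B" "Ide K A \<sqsubseteq> fr \<cdot> fl"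
    and g': "gl \<in> Hom K B D" "gr \<in> Hom K D B" "gl \<cdot> gr \<sqsubseteq> Ide K D" "Ide K B \<sqsubseteq> gr \<cdot> gl"
    using f g by (auto simp: Hom_Adj[OF category_axioms])
  have B: "Ide K B \<in> Hom K B B" and A: "Ide K A \<in> Hom K A A" and D: "Ide K D \<in> Hom K D D"
    using f'(1) g'(1) Ide_Hom Dom_Ob Cod_Ob by (auto simp: Hom_def)
  note H = f'(1,2) g'(1,2) Cmp_Hom[OF f'(1,2)] Cmp_Hom[OF f'(2,1)] Cmp_Hom[OF g'(1,2)]
    Cmp_Hom[OF g'(2,1)] Cmp_Hom[OF f'(1) g'(1)] Cmp_Hom[OF g'(2) f'(2)]
  have "(gl \<cdot> fl) \<cdot> (fr \<cdot> gr) = gl \<cdot> ((fl \<cdot> fr) \<cdot> gr)"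
    using H by (metis Cmp_assoc)
  moreover have "gl \<cdot> ((fl \<cdot> fr) \<cdot> gr) \<sqsubseteq> gl \<cdot> (Ide K B \<cdot> gr)"
    by (meson Cmp_Hom Cmp_mono_left Cmp_mono_right H B f'(3))
  moreover have "gl \<cdot> (Ide K B \<cdot> gr) = gl \<cdot> gr"
    by (simp add: Cmp_Ide_left[OF g'(2)])
  ultimately have 1: "(gl \<cdot> fl) \<cdot> (fr \<cdot> gr) \<sqsubseteq> Ide K D"
    using g'(3) D H transp_onD[OF Le_trans] by (metis Cmp_Hom)
  have "(fr \<cdot> gr) \<cdot> (gl \<cdot> fl) = fr \<cdot> ((gr \<cdot> gl) \<cdot> fl)"
    using H by (metis Cmp_assoc)
  moreover have "fr \<cdot> (Ide K B \<cdot> fl) \<sqsubseteq> fr \<cdot> ((gr \<cdot> gl) \<cdot> fl)"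
    by (meson Cmp_Hom Cmp_mono_left Cmp_mono_right H B g'(4))
  moreover have "fr \<cdot> (Ide K B \<cdot> fl) = fr \<cdot> fl"
    by (simp add: Cmp_Ide_left[OF f'(1)])
  ultimately have 2: "Ide K A \<sqsubseteq> (fr \<cdot> gr) \<cdot> (gl \<cdot> fl)"
    using f'(4) A H transp_onD[OF Le_trans] by (metis Cmp_Hom)
  show ?thesis
    using 1 2 H by (simp add: Hom_Adj[OF category_axioms]) (simp add: Adj_def)
qed

lemma category_Adj: "category (Adj K)"
proof
  have Cmp_eq: "g \<cdot>\<^bsub>Adj K\<^esub> f = (fst g \<cdot> fst f, snd f \<cdot> snd g)" for f g
    by (simp add: Adj_def)
  have Ide_eq: "Ide (Adj K) A = (Ide K A, Ide K A)" for A
    by (simp add: Adj_def)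
  have HomD: "fst f \<in> Hom K A B" "snd f \<in> Hom K B A" if "f \<in> Hom (Adj K) A B" for f A B
    using that by (auto simp: Hom_Adj[OF category_axioms])
  show "Dom (Adj K) f \<in> Ob (Adj K)" "Cod (Adj K) f \<in> Ob (Adj K)" if "f \<in> Arr (Adj K)" for f
    using that by (auto simp: Adj_def Hom_def)
  show "Ide (Adj K) A \<in> Hom (Adj K) A A" if "A \<in> Ob (Adj K)" for A
  proof -
    have A: "Ide K A \<in> Hom K A A" using that by (simp add: Adj_def Ide_Hom)
    show ?thesis
      using A reflp_onD[OF Le_refl A] Cmp_Ide_left[OF A]
      by (simp add: Hom_Adj[OF category_axioms] Ide_eq)
  qed
  show "g \<cdot>\<^bsub>Adj K\<^esub> f \<in> Hom (Adj K) A D"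
    if "f \<in> Hom (Adj K) A B" "g \<in> Hom (Adj K) B D" for f g A B D
    using that by (rule Adj_Cmp_Hom)
  show "Ide (Adj K) B \<cdot>\<^bsub>Adj K\<^esub> f = f" "f \<cdot>\<^bsub>Adj K\<^esub> Ide (Adj K) A = f"
    if "f \<in> Hom (Adj K) A B" for f A B
    using HomD[OF that] by (simp_all add: Cmp_eq Ide_eq Cmp_Ide_left Cmp_Ide_right)
  show "(h \<cdot>\<^bsub>Adj K\<^esub> g) \<cdot>\<^bsub>Adj K\<^esub> f = h \<cdot>\<^bsub>Adj K\<^esub> (g \<cdot>\<^bsub>Adj K\<^esub> f)"
    if "f \<in> Hom (Adj K) A B" "g \<in> Hom (Adj K) B D" "h \<in> Hom (Adj K) D E" for f g h A B D E
    using HomD[OF that(1)] HomD[OF that(2)] HomD[OF that(3)]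
    by (simp add: Cmp_eq Cmp_assoc)
qed

end

lemma is_functor_Adj_func:
  assumes K: "O_category K" and L: "O_category L" and F: "locally_continuous K L F"
  shows "is_functor (Adj K) (Adj L) (Adj_func F)"
proof -
  interpret K: O_category K by (fact K)
  interpret L: O_category L by (fact L)
  have obs: "A \<in> Ob K" "B \<in> Ob K" if "f \<in> Hom K A B" for f A B
    using that K.Dom_Ob K.Cod_Ob by (auto simp: Hom_def)
  have hom: "amap F f \<in> Hom L (omap F A) (omap F B)" if "f \<in> Hom K A B" for f A B
    using F that obs[OF that] by (simp add: locally_continuous_def is_functor_def)
  have ide: "amap F (Ide K A) = Ide L (omap F A)" if "A \<in> Ob K" for A
    using F that by (simp add: locally_continuous_def is_functor_def)
  have cmp: "amap F (g \<cdot>\<^bsub>K\<^esub> f) = amap F g \<cdot>\<^bsub>L\<^esub> amap F f"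
    if "f \<in> Hom K A B" "g \<in> Hom K B D" for f g A B D
    using F that by (simp add: locally_continuous_def is_functor_def Hom_def)
  have mono: "amap F f \<sqsubseteq>\<^bsub>L\<^esub> amap F g"
    if "f \<sqsubseteq>\<^bsub>K\<^esub> g" "f \<in> Hom K A B" "g \<in> Hom K A B" for f g A B
    using F that obs[OF that(2)] by (simp add: locally_continuous_def)
  have adj: "amap (Adj_func F) f \<in> Hom (Adj L) (omap F A) (omap F B)"
    if "f \<in> Hom (Adj K) A B" for f A B
  proof -
    obtain l r where [simp]: "f = (l, r)" by (cases f)
    have f: "l \<in> Hom K A B" "r \<in> Hom K B A"
        "l \<cdot>\<^bsub>K\<^esub> r \<sqsubseteq>\<^bsub>K\<^esub> Ide K B" "Ide K A \<sqsubseteq>\<^bsub>K\<^esub> r \<cdot>\<^bsub>K\<^esub> l"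
      using that by (auto simp: Hom_Adj[OF K.category_axioms])
    have AB: "A \<in> Ob K" "B \<in> Ob K"
      using obs[OF f(1)] by auto
    have "amap F l \<cdot>\<^bsub>L\<^esub> amap F r \<sqsubseteq>\<^bsub>L\<^esub> Ide L (omap F B)"
      using mono[OF f(3) K.Cmp_Hom[OF f(2,1)] K.Ide_Hom[OF AB(2)]]
      by (simp add: cmp[OF f(2,1)] ide AB)
    moreover have "Ide L (omap F A) \<sqsubseteq>\<^bsub>L\<^esub> amap F r \<cdot>\<^bsub>L\<^esub> amap F l"
      using mono[OF f(4) K.Ide_Hom[OF AB(1)] K.Cmp_Hom[OF f(1,2)]]
      by (simp add: cmp[OF f(1,2)] ide AB)
    ultimately show ?thesis
      using hom f by (simp add: Hom_Adj[OF L.category_axioms] Adj_func_def)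
  qed
  have cmp': "amap (Adj_func F) (g \<cdot>\<^bsub>Adj K\<^esub> f)
      = amap (Adj_func F) g \<cdot>\<^bsub>Adj L\<^esub> amap (Adj_func F) f"
    if fg: "f \<in> Arr (Adj K)" "g \<in> Arr (Adj K)" "Dom (Adj K) g = Cod (Adj K) f" for f g
  proof -
    have "fst f \<in> Hom K (Dom K (fst f)) (Cod K (fst f))"
        "snd f \<in> Hom K (Cod K (fst f)) (Dom K (fst f))"
        "fst g \<in> Hom K (Cod K (fst f)) (Cod K (fst g))"
        "snd g \<in> Hom K (Cod K (fst g)) (Cod K (fst f))"
      using fg by (auto simp: Adj_def Hom_def)
    then show ?thesis by (auto simp: Adj_func_def Adj_def cmp)
  qed
  have ob: "omap F A \<in> Ob L" if "A \<in> Ob K" for A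
    using F that by (auto simp: locally_continuous_def is_functor_def)
  have om: "omap (Adj_func F) = omap F" by (simp add: Adj_func_def)
  show ?thesis
    unfolding is_functor_def om
    using K.category_Adj L.category_Adj adj cmp' ob ide by (auto simp: Adj_def Adj_func_def)
qed

end

theory Submission
  imports Defs "HOL-Library.FuncSet"
begin

text \<open>
  A locally determined cocone is colimiting: the mediating morphism to a cocone \<open>d\<close> has left part
  \<open>\<Squnion>\<^sub>n d\<^sub>n\<^sup>L \<circ> c\<^sub>n\<^sup>R\<close> and right part \<open>\<Squnion>\<^sub>n c\<^sub>n\<^sup>L \<circ> d\<^sub>n\<^sup>R\<close>.
  Local determination is an equation between suprema of \<open>\<omega>\<close>-chains, so locally continuous
  functors preserve it. For the converse, take the representable functors \<open>K(A, -)\<close> into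
  \<open>\<omega>\<close>-cpos. There every \<open>\<omega>\<close>-chain \<open>K(A, \<Delta>)\<close> has a locally determined cocone, namely the limit
  of the right adjoints, and any colimiting cocone is isomorphic to it and hence locally
  determined. Evaluating the resulting suprema at identities, for \<open>A = C\<close> and \<open>A = \<Delta>\<^sub>n\<close>, yields
  local determination in \<open>K\<close>.
\<close>

section \<open>Adjoint pairs and locally determined cocones\<close>

text \<open>The obstacle in the converse is that a colimit in \<open>Adj K\<close> speaks of adjoint
  pairs only: it provides no least upper bounds, and \<open>K\<close> itself need not contain a
  locally determined cocone to compare the given one with. The functors into omega-cpos supply one,
  but only its right adjoints come for free, as projections from the limit. The left adjoint from
  stage n must have a k-th component from \<open>D n\<close> to \<open>D k\<close>, and every later
  stage p offers the candidate \<open>r k p \<cdot> l n p\<close>. Adjoint pairs need not be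
  embedding-projection pairs: units are mere inequalities, so these candidates increase with p
  instead of being constant, and the component is their supremum \<open>transition n k\<close>. The
  same slack explains the second clause of local determination:
  \<open>snd (c n) \<cdot> fst (c n)\<close> always lies above every
  \<open>r n m \<cdot> l n m\<close>, and its being their supremum keeps the mediating left part
  from exceeding \<open>fst (d n)\<close> on stage n.\<close>

lemma (in category) HomD:
  assumes "f \<in> Hom C A B"
  shows "f \<in> Arr C" "Dom C f = A" "Cod C f = B" "A \<in> Ob C" "B \<in> Ob C"
  using assms Dom_Ob Cod_Ob by (auto simp: Hom_def)

text \<open>With the simp rules that follow, \<open>simp\<close> normalises composites:
  associativity and identity laws fire once sources and targets of the factors are known. This is
  why proofs below declare instances of \<open>HomD\<close> as simp rules.\<close>

lemma (in category) Arr_Cmp [simp]: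
  assumes "f \<in> Arr C" "g \<in> Arr C" "Dom C g = Cod C f"
  shows "g \<cdot> f \<in> Arr C" "Dom C (g \<cdot> f) = Dom C f" "Cod C (g \<cdot> f) = Cod C g"
  using Cmp_Hom[of f "Dom C f" "Cod C f" g "Cod C g"] assms by (auto simp: Hom_def)

lemma (in category) Arr_Ide [simp]:
  assumes "A \<in> Ob C"
  shows "Ide C A \<in> Arr C" "Dom C (Ide C A) = A" "Cod C (Ide C A) = A"
  using Ide_Hom[OF assms] by (auto simp: Hom_def)

lemma (in category) Arr_assoc [simp]:
  assumes "f \<in> Arr C" "g \<in> Arr C" "h \<in> Arr C" "Dom C g = Cod C f" "Dom C h = Cod C g"
  shows "(h \<cdot> g) \<cdot> f = h \<cdot> (g \<cdot> f)"
  by (rule Cmp_assoc) (use assms in \<open>auto simp: Hom_def\<close>)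

lemma (in category) Arr_Ide_Cmp [simp]:
  assumes "f \<in> Arr C"
  shows "Cod C f = B \<Longrightarrow> Ide C B \<cdot> f = f" "Dom C f = A \<Longrightarrow> f \<cdot> Ide C A = f"
  using assms Cmp_Ide_left Cmp_Ide_right by (auto simp: Hom_def)

context O_category
begin

text \<open>\<open>Le\<close> has meaning only between parallel arrows; bundling the typing with it
  allows chains of inequalities without repeated membership side conditions.\<close>

definition hle :: "'o \<Rightarrow> 'o \<Rightarrow> 'm \<Rightarrow> 'm \<Rightarrow> bool" where
  "hle A B f g \<longleftrightarrow> f \<in> Hom K A B \<and> g \<in> Hom K A B \<and> f \<sqsubseteq> g"

lemma hle_refl: "f \<in> Hom K A B \<Longrightarrow> hle A B f f"
  using Le_refl reflp_onD unfolding hle_def by metis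

lemma hle_trans [trans]: "hle A B f g \<Longrightarrow> hle A B g h \<Longrightarrow> hle A B f h"
  using transp_onD[OF Le_trans] unfolding hle_def by metis

lemma hle_antisym: "hle A B f g \<Longrightarrow> hle A B g f \<Longrightarrow> f = g"
  using antisymp_onD[OF Le_antisym] unfolding hle_def by metis

lemma hle_Cmp:
  assumes "hle A B f f'" "hle B D g g'"
  shows "hle A D (g \<cdot> f) (g' \<cdot> f')"
proof (rule hle_trans)
  show "hle A D (g \<cdot> f) (g \<cdot> f')"
    using assms Cmp_Hom Cmp_mono_right unfolding hle_def by metis
  show "hle A D (g \<cdot> f') (g' \<cdot> f')"
    using assms Cmp_Hom Cmp_mono_left unfolding hle_def by metis
qed

lemma hle_Cmp_left: "hle B D g g' \<Longrightarrow> f \<in> Hom K A B \<Longrightarrow> hle A D (g \<cdot> f) (g' \<cdot> f)"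
  by (rule hle_Cmp[OF hle_refl])

lemma hle_Cmp_right: "hle A B f f' \<Longrightarrow> g \<in> Hom K B D \<Longrightarrow> hle A D (g \<cdot> f) (g \<cdot> f')"
  by (rule hle_Cmp[OF _ hle_refl])

lemma is_lub_upper: "is_lub K A B S x \<Longrightarrow> S \<subseteq> Hom K A B \<Longrightarrow> f \<in> S \<Longrightarrow> hle A B f x"
  unfolding is_lub_def hle_def by auto

lemma is_lub_least:
  "is_lub K A B S x \<Longrightarrow> y \<in> Hom K A B \<Longrightarrow> (\<And>f. f \<in> S \<Longrightarrow> hle A B f y) \<Longrightarrow> hle A B x y"
  unfolding is_lub_def hle_def by auto

lemma is_lubI:
  assumes "x \<in> Hom K A B" "\<And>f. f \<in> S \<Longrightarrow> hle A B f x"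
    "\<And>y. y \<in> Hom K A B \<Longrightarrow> (\<And>f. f \<in> S \<Longrightarrow> hle A B f y) \<Longrightarrow> hle A B x y"
  shows "is_lub K A B S x"
proof -
  have "S \<subseteq> Hom K A B" using assms(2) by (auto simp: hle_def)
  then show ?thesis
    unfolding is_lub_def using assms unfolding hle_def by blast
qed

lemma is_lub_unique:
  assumes "is_lub K A B S x" "is_lub K A B S y" "S \<subseteq> Hom K A B"
  shows "x = y"
  using assms unfolding is_lub_def by (metis antisymp_onD[OF Le_antisym])

text \<open>Mutually dominating families have the same upper bounds. This serves to change the stage
  at which a chain of composites starts.\<close>

lemma is_lub_cofinal:
  assumes S: "is_lub K A B S x" "S \<subseteq> Hom K A B"
    and "\<And>f. f \<in> S \<Longrightarrow> \<exists>g \<in> T. hle A B f g"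
    and "\<And>g. g \<in> T \<Longrightarrow> \<exists>f \<in> S. hle A B g f"
  shows "is_lub K A B T x"
proof (rule is_lubI)
  show "x \<in> Hom K A B" using S by (simp add: is_lub_def)
  show "hle A B g x" if "g \<in> T" for g
    using assms(4)[OF that] is_lub_upper[OF S] hle_trans by blast
  show "hle A B x y" if "y \<in> Hom K A B" "\<And>g. g \<in> T \<Longrightarrow> hle A B g y" for y
    using is_lub_least[OF S(1) that(1)] assms(3) that(2) hle_trans by blast
qed

lemma omega_chain_in_hle:
  assumes "omega_chain_in K A B f" "n \<le> m"
  shows "hle A B (f n) (f m)"
  using assms(2)
proof (induction rule: dec_induct)
  case base
  then show ?case using assms hle_refl by (auto simp: omega_chain_in_def)
next
  case (step m)
  have "hle A B (f m) (f (Suc m))" using assms by (auto simp: omega_chain_in_def hle_def)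
  with step.IH show ?case by (rule hle_trans)
qed

lemma omega_chain_in_Hom: "omega_chain_in K A B f \<Longrightarrow> range f \<subseteq> Hom K A B"
  by (auto simp: omega_chain_in_def)

lemma omega_chain_inI: "(\<And>n. hle A B (f n) (f (Suc n))) \<Longrightarrow> omega_chain_in K A B f"
  by (auto simp: omega_chain_in_def hle_def)

lemma AdjD:
  assumes "f \<in> Hom (Adj K) A B"
  shows "fst f \<in> Hom K A B" "snd f \<in> Hom K B A"
    "hle B B (fst f \<cdot> snd f) (Ide K B)" "hle A A (Ide K A) (snd f \<cdot> fst f)"
    "A \<in> Ob K" "B \<in> Ob K"
proof -
  show 1: "fst f \<in> Hom K A B" "snd f \<in> Hom K B A"
    using assms by (auto simp: Hom_Adj[OF category_axioms])
  show "A \<in> Ob K" "B \<in> Ob K" using HomD[OF 1(1)] by auto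
  then show "hle B B (fst f \<cdot> snd f) (Ide K B)" "hle A A (Ide K A) (snd f \<cdot> fst f)"
    using assms Cmp_Hom[OF 1] Cmp_Hom[OF 1(2,1)] Ide_Hom
    by (auto simp: Hom_Adj[OF category_axioms] hle_def)
qed

lemma AdjI:
  "l \<in> Hom K A B \<Longrightarrow> r \<in> Hom K B A \<Longrightarrow> hle B B (l \<cdot> r) (Ide K B) \<Longrightarrow> hle A A (Ide K A) (r \<cdot> l) \<Longrightarrow>
    (l, r) \<in> Hom (Adj K) A B"
  by (auto simp: Hom_Adj[OF category_axioms] hle_def)

text \<open>The unit gives one inequality, the counit the other; in an ordered setting antisymmetry
  makes the triangle law an equation.\<close>

lemma Adj_triangle:
  assumes f: "f \<in> Hom (Adj K) A B"
  shows "fst f \<cdot> (snd f \<cdot> fst f) = fst f"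
proof (rule hle_antisym)
  note [simp] = AdjD(5,6)[OF f] HomD[OF AdjD(1)[OF f]] HomD[OF AdjD(2)[OF f]]
  show "hle A B (fst f \<cdot> (snd f \<cdot> fst f)) (fst f)"
    using hle_Cmp_left[OF AdjD(3,1)[OF f]] by simp
  show "hle A B (fst f) (fst f \<cdot> (snd f \<cdot> fst f))"
    using hle_Cmp_right[OF AdjD(4,1)[OF f]] by simp
qed

text \<open>Insert the unit of \<open>f\<close>, enlarge its left part to that of \<open>g\<close>,
  and cancel with the counit of \<open>g\<close>.\<close>

lemma Adj_fst_anti:
  assumes f: "f \<in> Hom (Adj K) A B" and g: "g \<in> Hom (Adj K) A B" and "hle A B (fst f) (fst g)"
  shows "hle B A (snd g) (snd f)"
proof -
  note [simp] = AdjD(5,6)[OF f] HomD[OF AdjD(1)[OF f]] HomD[OF AdjD(2)[OF f]]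
    HomD[OF AdjD(1)[OF g]] HomD[OF AdjD(2)[OF g]]
  have "hle B A (snd g) (snd f \<cdot> (fst f \<cdot> snd g))"
    using hle_Cmp_left[OF AdjD(4)[OF f] AdjD(2)[OF g]] by simp
  also have "hle B A (snd f \<cdot> (fst f \<cdot> snd g)) (snd f \<cdot> (fst g \<cdot> snd g))"
    by (intro hle_Cmp_right[OF _ AdjD(2)[OF f]] hle_Cmp_left[OF assms(3)] AdjD[OF g])
  also have "hle B A (snd f \<cdot> (fst g \<cdot> snd g)) (snd f)"
    using hle_Cmp_right[OF AdjD(3)[OF g] AdjD(2)[OF f]] by simp
  finally show ?thesis .
qed

text \<open>Antitonicity in both directions forces the right parts to agree, so equations and
  uniqueness claims in \<open>Adj K\<close> reduce to left parts.\<close>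

lemma Adj_eqI:
  assumes "f \<in> Hom (Adj K) A B" "g \<in> Hom (Adj K) A B" "fst f = fst g"
  shows "f = g"
  using Adj_fst_anti[OF assms(1,2)] Adj_fst_anti[OF assms(2,1)] hle_refl AdjD(1)[OF assms(1)]
    AdjD(1)[OF assms(2)] assms(3) by (metis hle_antisym prod_eqI)

lemma Cmp_Adj: "g \<cdot>\<^bsub>Adj K\<^esub> f = (fst g \<cdot> fst f, snd f \<cdot> snd g)"
  by (simp add: Adj_def)

lemma Ide_Adj: "Ide (Adj K) A = (Ide K A, Ide K A)"
  by (simp add: Adj_def)

lemma Ob_Adj: "Ob (Adj K) = Ob K"
  by (simp add: Adj_def)

end

lemma Ob_nat_cat: "Ob nat_cat = UNIV"
  by (simp add: nat_cat_def)

section \<open>Omega-chains of adjoint pairs and their cocones\<close>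

locale adjoint_chain = O_category K for K :: "('o, 'm, 'x) ocat_scheme" (structure) +
  fixes \<Delta> :: "(nat, nat \<times> nat, 'o, 'm \<times> 'm) func"
  assumes functor_chain: "is_functor nat_cat (Adj K) \<Delta>"
begin

abbreviation "D \<equiv> omap \<Delta>"
abbreviation "l n m \<equiv> fst (amap \<Delta> (n, m))"
abbreviation "r n m \<equiv> snd (amap \<Delta> (n, m))"

lemma Adj_chain: "n \<le> m \<Longrightarrow> amap \<Delta> (n, m) \<in> Hom (Adj K) (D n) (D m)"
proof -
  assume "n \<le> m"
  then have "n \<in> Ob nat_cat" "m \<in> Ob nat_cat" "(n, m) \<in> Hom nat_cat n m"
    by (simp_all add: nat_cat_def Hom_def)
  then show ?thesis using functor_chain unfolding is_functor_def by metis
qed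

lemma chain_Cmp:
  assumes "n \<le> m" "m \<le> k"
  shows "amap \<Delta> (m, k) \<cdot>\<^bsub>Adj K\<^esub> amap \<Delta> (n, m) = amap \<Delta> (n, k)"
proof -
  have "(n, m) \<in> Arr nat_cat" "(m, k) \<in> Arr nat_cat" "Dom nat_cat (m, k) = Cod nat_cat (n, m)"
    "(m, k) \<cdot>\<^bsub>nat_cat\<^esub> (n, m) = (n, k)"
    using assms by (auto simp: nat_cat_def)
  then show ?thesis using functor_chain unfolding is_functor_def by metis
qed

lemma l_Cmp: "n \<le> m \<Longrightarrow> m \<le> k \<Longrightarrow> l m k \<cdot> l n m = l n k"
  and r_Cmp: "n \<le> m \<Longrightarrow> m \<le> k \<Longrightarrow> r n m \<cdot> r m k = r n k"
  using chain_Cmp[of n m k] by (metis Cmp_Adj fst_conv snd_conv)+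

lemma D_Ob: "D n \<in> Ob K"
  by (rule AdjD(5)[OF Adj_chain[OF order_refl]])

lemma l_r_refl: "l n n = Ide K (D n)" "r n n = Ide K (D n)"
proof -
  have "Ide nat_cat n = (n, n)" "n \<in> Ob nat_cat" by (simp_all add: nat_cat_def)
  then have "amap \<Delta> (n, n) = Ide (Adj K) (D n)"
    using functor_chain unfolding is_functor_def by metis
  then show "l n n = Ide K (D n)" "r n n = Ide K (D n)" by (simp_all add: Ide_Adj)
qed

lemma l_Hom: "n \<le> m \<Longrightarrow> l n m \<in> Hom K (D n) (D m)"
  and r_Hom: "n \<le> m \<Longrightarrow> r n m \<in> Hom K (D m) (D n)"
  by (erule AdjD(1)[OF Adj_chain], erule AdjD(2)[OF Adj_chain])

lemmas l_Arr [simp] = HomD(1-3)[OF l_Hom]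
lemmas r_Arr [simp] = HomD(1-3)[OF r_Hom]
declare D_Ob [simp]

lemma l_r_hle: "n \<le> m \<Longrightarrow> hle (D m) (D m) (l n m \<cdot> r n m) (Ide K (D m))"
  and r_l_hle: "n \<le> m \<Longrightarrow> hle (D n) (D n) (Ide K (D n)) (r n m \<cdot> l n m)"
  by (erule AdjD(3)[OF Adj_chain], erule AdjD(4)[OF Adj_chain])

text \<open>Composition is reversed in the second equation because right parts are contravariant:
  the right legs form a cone over the chain of right adjoints.\<close>

lemma cocone_iff: "cocone nat_cat (Adj K) \<Delta> X c \<longleftrightarrow> X \<in> Ob K \<and> (\<forall>n. c n \<in> Hom (Adj K) (D n) X)
   \<and> (\<forall>n m. n \<le> m \<longrightarrow> fst (c m) \<cdot> l n m = fst (c n) \<and> r n m \<cdot> snd (c m) = snd (c n))"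
proof -
  have "(\<forall>u \<in> Arr nat_cat. P (Cod nat_cat u) u (Dom nat_cat u)) \<longleftrightarrow> (\<forall>n m. n \<le> m \<longrightarrow> P m (n, m) n)"
    for P :: "nat \<Rightarrow> nat \<times> nat \<Rightarrow> nat \<Rightarrow> bool"
    by (auto simp: nat_cat_def Ball_def)
  from this[of "\<lambda>m u n. c m \<cdot>\<^bsub>Adj K\<^esub> amap \<Delta> u = c n"] show ?thesis
    unfolding cocone_def by (simp add: Cmp_Adj Ob_Adj prod_eq_iff Ob_nat_cat)
qed

end

locale adjoint_cocone = adjoint_chain +
  fixes X c
  assumes cocone: "cocone nat_cat (Adj K) \<Delta> X c"
begin

lemma Adj_leg: "c n \<in> Hom (Adj K) (D n) X"
  using cocone by (simp add: cocone_iff)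

lemma cl_Cmp: "n \<le> m \<Longrightarrow> fst (c m) \<cdot> l n m = fst (c n)"
  and cr_Cmp: "n \<le> m \<Longrightarrow> r n m \<cdot> snd (c m) = snd (c n)"
  using cocone by (simp_all add: cocone_iff)

lemmas cl_Hom = AdjD(1)[OF Adj_leg]
lemmas cr_Hom = AdjD(2)[OF Adj_leg]
lemmas cl_Arr [simp] = HomD(1-3)[OF cl_Hom]
lemmas cr_Arr [simp] = HomD(1-3)[OF cr_Hom]

lemma X_Ob [simp]: "X \<in> Ob K"
  using cocone by (simp add: cocone_iff)

lemma cl_cr_hle: "hle X X (fst (c n) \<cdot> snd (c n)) (Ide K X)"
  and cr_cl_hle: "hle (D n) (D n) (Ide K (D n)) (snd (c n) \<cdot> fst (c n))"
  by (rule AdjD(3)[OF Adj_leg], rule AdjD(4)[OF Adj_leg])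

text \<open>Writing the index as \<open>n + i\<close> makes the second family a sequence over all of
  \<open>nat\<close>, the form in which the lub axioms of an O-category apply.\<close>

lemma locally_determined_iff:
  "locally_determined K \<Delta> X c \<longleftrightarrow>
    is_lub K X X (range (\<lambda>n. fst (c n) \<cdot> snd (c n))) (Ide K X)
    \<and> (\<forall>n. is_lub K (D n) (D n) (range (\<lambda>i. r n (n + i) \<cdot> l n (n + i))) (snd (c n) \<cdot> fst (c n)))"
proof -
  have 1: "{fst (c n) \<cdot> snd (c n) | n. True} = range (\<lambda>n. fst (c n) \<cdot> snd (c n))"
    by auto
  have 2: "{r n m \<cdot> l n m | m. m \<ge> n} = range (\<lambda>i. r n (n + i) \<cdot> l n (n + i))" for n
    by (auto simp: le_iff_add)
  show ?thesis unfolding locally_determined_def 1 2 ..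
qed

end

section \<open>Locally determined cocones are colimiting\<close>

context adjoint_chain
begin

text \<open>The earlier term is the later one with \<open>l n m \<cdot> r n m\<close> inserted,
  which the counit bounds by the identity. It is used for both parts of the mediating pair and for a
  cocone against itself.\<close>

lemma mediating_mono:
  assumes "adjoint_cocone K \<Delta> X c" "adjoint_cocone K \<Delta> Y d" "n \<le> m"
  shows "hle X Y (fst (d n) \<cdot> snd (c n)) (fst (d m) \<cdot> snd (c m))"
proof -
  interpret c: adjoint_cocone K \<Delta> X c by fact
  interpret d: adjoint_cocone K \<Delta> Y d by fact
  have "fst (d n) \<cdot> snd (c n) = fst (d m) \<cdot> ((l n m \<cdot> r n m) \<cdot> snd (c m))"
    using assms(3) by (simp flip: c.cr_Cmp[OF assms(3)] d.cl_Cmp[OF assms(3)])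
  moreover have "hle X Y (fst (d m) \<cdot> ((l n m \<cdot> r n m) \<cdot> snd (c m))) (fst (d m) \<cdot> snd (c m))"
    using hle_Cmp_right[OF hle_Cmp_left[OF l_r_hle[OF assms(3)] c.cr_Hom] d.cl_Hom] by simp
  ultimately show ?thesis by simp
qed

text \<open>Here the later term is the earlier one with \<open>r i j \<cdot> l i j\<close> inserted,
  which the unit places above the identity.\<close>

lemma r_l_mono:
  assumes "n \<le> i" "k \<le> i" "i \<le> j"
  shows "hle (D n) (D k) (r k i \<cdot> l n i) (r k j \<cdot> l n j)"
proof -
  have "r k j \<cdot> l n j = r k i \<cdot> ((r i j \<cdot> l i j) \<cdot> l n i)"
    using assms by (simp flip: l_Cmp[OF assms(1,3)] r_Cmp[OF assms(2,3)])
  moreover have "hle (D n) (D k) (r k i \<cdot> l n i) (r k i \<cdot> ((r i j \<cdot> l i j) \<cdot> l n i))"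
    using hle_Cmp_right[OF hle_Cmp_left[OF r_l_hle[OF assms(3)] l_Hom[OF assms(1)]] r_Hom[OF assms(2)]]
      assms by simp
  ultimately show ?thesis by simp
qed

text \<open>Factor \<open>fst (d n)\<close> through stage \<open>m\<close>; the triangle law of
  \<open>amap \<Delta> (n, m)\<close> then absorbs \<open>r n m \<cdot> l n m\<close>, although that
  composite may exceed the identity.\<close>

lemma cl_r_l:
  assumes "adjoint_cocone K \<Delta> Y d" "n \<le> m"
  shows "fst (d n) \<cdot> (r n m \<cdot> l n m) = fst (d n)"
proof -
  interpret d: adjoint_cocone K \<Delta> Y d by fact
  have "fst (d n) \<cdot> (r n m \<cdot> l n m) = fst (d m) \<cdot> (l n m \<cdot> (r n m \<cdot> l n m))"
    using assms(2) by (simp flip: d.cl_Cmp[OF assms(2)])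
  also have "\<dots> = fst (d n)"
    by (simp only: Adj_triangle[OF Adj_chain[OF assms(2)]] d.cl_Cmp[OF assms(2)])
  finally show ?thesis .
qed

lemma locally_determined_imp_colimiting:
  assumes cocone: "cocone nat_cat (Adj K) \<Delta> X c" and ld: "locally_determined K \<Delta> X c"
  shows "colimiting nat_cat (Adj K) \<Delta> X c"
proof -
  have cc: "adjoint_cocone K \<Delta> X c" by unfold_locales (fact cocone)
  interpret c: adjoint_cocone K \<Delta> X c by (fact cc)
  have lub_id: "is_lub K X X (range (\<lambda>n. fst (c n) \<cdot> snd (c n))) (Ide K X)"
    and lub_leg: "is_lub K (D n) (D n) (range (\<lambda>i. r n (n + i) \<cdot> l n (n + i))) (snd (c n) \<cdot> fst (c n))" for n
    using ld by (auto simp: c.locally_determined_iff)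
  have chain_id: "omega_chain_in K X X (\<lambda>n. fst (c n) \<cdot> snd (c n))"
    by (rule omega_chain_inI) (simp add: mediating_mono[OF cc cc])
  have chain_leg: "omega_chain_in K (D n) (D n) (\<lambda>i. r n (n + i) \<cdot> l n (n + i))" for n
    by (rule omega_chain_inI) (simp add: r_l_mono)
  have "\<exists>!h. h \<in> Hom (Adj K) X Y \<and> (\<forall>j. h \<cdot>\<^bsub>Adj K\<^esub> c j = d j)"
    if d: "cocone nat_cat (Adj K) \<Delta> Y d" for Y d
  proof -
    have dd: "adjoint_cocone K \<Delta> Y d" by unfold_locales (fact d)
    interpret d: adjoint_cocone K \<Delta> Y d by (fact dd)
    \<comment> \<open>The second clause of local determination enters here: it writes
      \<open>snd (c n) \<cdot> fst (c n)\<close> as a supremum of composites of the chain, each of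
      which any cocone absorbs by \<open>cl_r_l\<close>.\<close>
    have absorb: "hle (D n) Y (fst (d n) \<cdot> (snd (c n) \<cdot> fst (c n))) (fst (d n))" for n
      by (rule is_lub_least[OF Cmp_lub_right[OF d.cl_Hom chain_leg lub_leg] d.cl_Hom])
        (auto simp: cl_r_l[OF dd] intro: hle_refl d.cl_Hom)
    have chain_L: "omega_chain_in K X Y (\<lambda>n. fst (d n) \<cdot> snd (c n))"
      by (rule omega_chain_inI) (simp add: mediating_mono[OF cc dd])
    have chain_R: "omega_chain_in K Y X (\<lambda>n. fst (c n) \<cdot> snd (d n))"
      by (rule omega_chain_inI) (simp add: mediating_mono[OF dd cc])
    obtain hL where hL: "is_lub K X Y (range (\<lambda>n. fst (d n) \<cdot> snd (c n))) hL"
      using lub_exists[OF chain_L] by blast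
    obtain hR where hR: "is_lub K Y X (range (\<lambda>n. fst (c n) \<cdot> snd (d n))) hR"
      using lub_exists[OF chain_R] by blast
    have hL_Hom: "hL \<in> Hom K X Y" and hR_Hom: "hR \<in> Hom K Y X"
      using hL hR by (auto simp: is_lub_def)
    note [simp] = HomD(1-3)[OF hL_Hom] HomD(1-3)[OF hR_Hom]
    have hL_upper: "hle X Y (fst (d n) \<cdot> snd (c n)) hL"
      and hR_upper: "hle Y X (fst (c n) \<cdot> snd (d n)) hR" for n
      using is_lub_upper[OF hL omega_chain_in_Hom[OF chain_L]]
        is_lub_upper[OF hR omega_chain_in_Hom[OF chain_R]] by auto
    have hL_cl: "hL \<cdot> fst (c n) = fst (d n)" for n
    proof (rule hle_antisym)
      have "hle (D n) Y (fst (d n)) (fst (d n) \<cdot> (snd (c n) \<cdot> fst (c n)))"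
        using hle_Cmp_right[OF c.cr_cl_hle d.cl_Hom] by simp
      also have "hle (D n) Y (fst (d n) \<cdot> (snd (c n) \<cdot> fst (c n))) (hL \<cdot> fst (c n))"
        using hle_Cmp_left[OF hL_upper c.cl_Hom] by simp
      finally show "hle (D n) Y (fst (d n)) (hL \<cdot> fst (c n))" .
      show "hle (D n) Y (hL \<cdot> fst (c n)) (fst (d n))"
      proof (rule is_lub_least[OF Cmp_lub_left[OF chain_L hL c.cl_Hom] d.cl_Hom], elim rangeE)
        fix f m assume f: "f = (fst (d m) \<cdot> snd (c m)) \<cdot> fst (c n)"
        \<comment> \<open>At the common stage \<open>k\<close> both legs have the same index, and
          factoring \<open>fst (c n)\<close> as \<open>fst (c k) \<cdot> l n k\<close> produces the
          composite that \<open>absorb\<close> bounds.\<close>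
        define k where "k = max m n"
        have k: "m \<le> k" "n \<le> k" by (auto simp: k_def)
        have "hle (D n) Y f ((fst (d k) \<cdot> snd (c k)) \<cdot> fst (c n))"
          unfolding f by (rule hle_Cmp_left[OF mediating_mono[OF cc dd k(1)] c.cl_Hom])
        also have "(fst (d k) \<cdot> snd (c k)) \<cdot> fst (c n) = (fst (d k) \<cdot> (snd (c k) \<cdot> fst (c k))) \<cdot> l n k"
          using k by (simp flip: c.cl_Cmp[OF k(2)])
        also have "hle (D n) Y \<dots> (fst (d k) \<cdot> l n k)"
          by (rule hle_Cmp_left[OF absorb l_Hom[OF k(2)]])
        also have "fst (d k) \<cdot> l n k = fst (d n)" by (rule d.cl_Cmp[OF k(2)])
        finally show "hle (D n) Y f (fst (d n))" .
      qed
    qed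
    \<comment> \<open>The two suprema are peeled off separately, leaving independent indices
      \<open>m\<close> and \<open>n\<close>. Monotonicity moves both to \<open>max m n\<close>,
      where \<open>absorb\<close> and the counit of \<open>d\<close> apply.\<close>
    have counit: "hle Y Y (hL \<cdot> hR) (Ide K Y)"
    proof (rule is_lub_least[OF Cmp_lub_left[OF chain_L hL hR_Hom] Ide_Hom[OF d.X_Ob]], elim rangeE)
      fix f m assume f: "f = (fst (d m) \<cdot> snd (c m)) \<cdot> hR"
      have "fst (d m) \<cdot> snd (c m) \<in> Hom K X Y"
        using Cmp_Hom[OF c.cr_Hom d.cl_Hom] .
      then show "hle Y Y f (Ide K Y)" unfolding f
      proof (rule is_lub_least[OF Cmp_lub_right[OF _ chain_R hR] Ide_Hom[OF d.X_Ob]], elim rangeE)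
        fix g n assume g: "g = (fst (d m) \<cdot> snd (c m)) \<cdot> (fst (c n) \<cdot> snd (d n))"
        define k where "k = max m n"
        have k: "m \<le> k" "n \<le> k" by (auto simp: k_def)
        have "hle Y Y g ((fst (d k) \<cdot> snd (c k)) \<cdot> (fst (c k) \<cdot> snd (d k)))"
          unfolding g by (rule hle_Cmp[OF mediating_mono[OF dd cc k(2)] mediating_mono[OF cc dd k(1)]])
        also have "(fst (d k) \<cdot> snd (c k)) \<cdot> (fst (c k) \<cdot> snd (d k))
            = (fst (d k) \<cdot> (snd (c k) \<cdot> fst (c k))) \<cdot> snd (d k)" by simp
        also have "hle Y Y \<dots> (fst (d k) \<cdot> snd (d k))"
          by (rule hle_Cmp_left[OF absorb d.cr_Hom])
        also have "hle Y Y (fst (d k) \<cdot> snd (d k)) (Ide K Y)" by (rule d.cl_cr_hle)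
        finally show "hle Y Y g (Ide K Y)" .
      qed
    qed
    \<comment> \<open>The first clause of local determination reduces this to single terms
      \<open>fst (c n) \<cdot> snd (c n)\<close>; the unit of \<open>d n\<close>, inserted in the
      middle, puts each below a product of the \<open>n\<close>-th approximants of \<open>hR\<close>
      and \<open>hL\<close>.\<close>
    have unit: "hle X X (Ide K X) (hR \<cdot> hL)"
    proof (rule is_lub_least[OF lub_id Cmp_Hom[OF hL_Hom hR_Hom]], elim rangeE)
      fix f n assume f: "f = fst (c n) \<cdot> snd (c n)"
      have "hle X X f (fst (c n) \<cdot> ((snd (d n) \<cdot> fst (d n)) \<cdot> snd (c n)))"
        using hle_Cmp_right[OF hle_Cmp_left[OF d.cr_cl_hle c.cr_Hom] c.cl_Hom] by (simp add: f)
      also have "\<dots> = (fst (c n) \<cdot> snd (d n)) \<cdot> (fst (d n) \<cdot> snd (c n))" by simp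
      also have "hle X X \<dots> (hR \<cdot> hL)" by (rule hle_Cmp[OF hL_upper hR_upper])
      finally show "hle X X f (hR \<cdot> hL)" .
    qed
    have h: "(hL, hR) \<in> Hom (Adj K) X Y"
      by (rule AdjI[OF hL_Hom hR_Hom counit unit])
    show ?thesis
    proof (rule ex1I[of _ "(hL, hR)"], intro conjI allI)
      show "(hL, hR) \<in> Hom (Adj K) X Y" by (fact h)
      show "(hL, hR) \<cdot>\<^bsub>Adj K\<^esub> c j = d j" for j
        by (rule Adj_eqI[OF Adj_Cmp_Hom[OF c.Adj_leg h] d.Adj_leg]) (simp add: Cmp_Adj hL_cl)
      fix g assume g: "g \<in> Hom (Adj K) X Y \<and> (\<forall>j. g \<cdot>\<^bsub>Adj K\<^esub> c j = d j)"
      have gL_Hom: "fst g \<in> Hom K X Y" using g AdjD by blast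
      note [simp] = HomD(1-3)[OF gL_Hom]
      have gc: "fst g \<cdot> fst (c n) = fst (d n)" for n
        using g by (metis Cmp_Adj fst_conv)
      \<comment> \<open>Composing \<open>fst g\<close> with the supremum \<open>Ide K X\<close> of
        the first clause exhibits it as a lub of the very terms that define
        \<open>hL\<close>.\<close>
      have "fst g \<cdot> (fst (c n) \<cdot> snd (c n)) = (fst g \<cdot> fst (c n)) \<cdot> snd (c n)" for n
        by simp
      then have "fst g \<cdot> (fst (c n) \<cdot> snd (c n)) = fst (d n) \<cdot> snd (c n)" for n
        by (simp only: gc)
      then have "is_lub K X Y (range (\<lambda>n. fst (d n) \<cdot> snd (c n))) (fst g)"
        using Cmp_lub_right[OF gL_Hom chain_id lub_id] by simp
      from is_lub_unique[OF this hL omega_chain_in_Hom[OF chain_L]]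
      show "g = (hL, hR)" by (intro Adj_eqI[OF _ h]) (use g in auto)
    qed
  qed
  then show ?thesis
    unfolding colimiting_def using cocone by (simp add: Ob_nat_cat)
qed

end

section \<open>Locally continuous functors and isomorphic colimits\<close>

lemma is_functor_func_comp:
  assumes F: "is_functor C D F" and G: "is_functor D E G"
  shows "is_functor C E (func_comp G F)"
proof -
  interpret C: category C using F by (simp add: is_functor_def)
  interpret D: category D using F by (simp add: is_functor_def)
  have hom: "amap F f \<in> Hom D (omap F (Dom C f)) (omap F (Cod C f))" if "f \<in> Arr C" for f
    using F C.Dom_Ob[OF that] C.Cod_Ob[OF that] that by (auto simp: is_functor_def Hom_def)
  have "amap G (amap F (g \<cdot>\<^bsub>C\<^esub> f)) = amap G (amap F g) \<cdot>\<^bsub>E\<^esub> amap G (amap F f)"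
    if "f \<in> Arr C" "g \<in> Arr C" "Dom C g = Cod C f" for f g
    using F G that D.HomD[OF hom[OF that(1)]] D.HomD[OF hom[OF that(2)]] by (simp add: is_functor_def)
  then show ?thesis
    using F G unfolding is_functor_def func_comp_def by simp
qed

lemma cocone_func_comp:
  assumes D: "is_functor J C D" and G: "is_functor C E G" and c: "cocone J C D X c"
  shows "cocone J E (func_comp G D) (omap G X) (\<lambda>j. amap G (c j))"
proof -
  interpret J: category J using D by (simp add: is_functor_def)
  interpret C: category C using D by (simp add: is_functor_def)
  have D_hom: "amap D u \<in> Hom C (omap D (Dom J u)) (omap D (Cod J u))" if "u \<in> Arr J" for u
    using D J.Dom_Ob[OF that] J.Cod_Ob[OF that] that by (auto simp: is_functor_def Hom_def)
  have c_hom: "c j \<in> Hom C (omap D j) X" if "j \<in> Ob J" for j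
    using c that by (simp add: cocone_def)
  have "amap G (c (Cod J u)) \<cdot>\<^bsub>E\<^esub> amap G (amap D u) = amap G (c (Dom J u))" if u: "u \<in> Arr J" for u
  proof -
    have "amap G (c (Cod J u) \<cdot>\<^bsub>C\<^esub> amap D u) = amap G (c (Cod J u)) \<cdot>\<^bsub>E\<^esub> amap G (amap D u)"
      using G C.HomD[OF c_hom[OF J.Cod_Ob[OF u]]] C.HomD[OF D_hom[OF u]] by (simp add: is_functor_def)
    then show ?thesis using c u by (simp add: cocone_def)
  qed
  moreover have "amap G (c j) \<in> Hom E (omap G (omap D j)) (omap G X)" if "j \<in> Ob J" for j
    using G C.HomD[OF c_hom[OF that]] c_hom[OF that] by (simp add: is_functor_def)
  moreover have "omap G X \<in> Ob E" using G c by (simp add: is_functor_def cocone_def)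
  ultimately show ?thesis by (simp add: cocone_def func_comp_def)
qed

locale locally_continuous_functor = K: O_category K + L: O_category L
  for K :: "('o, 'm, 'x) ocat_scheme" and L :: "('p, 'q, 'y) ocat_scheme" +
  fixes F :: "('o, 'm, 'p, 'q) func"
  assumes F: "locally_continuous K L F"
begin

lemma amap_Ide: "A \<in> Ob K \<Longrightarrow> amap F (Ide K A) = Ide L (omap F A)"
  using F by (simp add: locally_continuous_def is_functor_def)

lemma amap_Cmp: "f \<in> Hom K A B \<Longrightarrow> g \<in> Hom K B C \<Longrightarrow> amap F (g \<cdot>\<^bsub>K\<^esub> f) = amap F g \<cdot>\<^bsub>L\<^esub> amap F f"
  using F by (simp add: locally_continuous_def is_functor_def Hom_def)

lemma amap_lub:
  assumes "omega_chain_in K A B fs" "is_lub K A B (range fs) f"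
  shows "is_lub L (omap F A) (omap F B) (range (\<lambda>n. amap F (fs n))) (amap F f)"
proof -
  have "f \<in> Hom K A B" using assms(2) by (simp add: is_lub_def)
  then show ?thesis using F K.HomD assms by (simp add: locally_continuous_def)
qed

lemma adjoint_chain_image:
  assumes "adjoint_chain K \<Delta>"
  shows "adjoint_chain L (func_comp (Adj_func F) \<Delta>)"
  using is_functor_func_comp is_functor_Adj_func[OF K.O_category_axioms L.O_category_axioms F]
    adjoint_chain.functor_chain[OF assms]
  by unfold_locales blast

lemma adjoint_cocone_image:
  assumes "adjoint_cocone K \<Delta> X c"
  shows "adjoint_cocone L (func_comp (Adj_func F) \<Delta>) (omap F X) (\<lambda>n. amap (Adj_func F) (c n))"
proof -
  interpret adjoint_cocone K \<Delta> X c by fact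
  interpret FD: adjoint_chain L "func_comp (Adj_func F) \<Delta>"
    by (rule adjoint_chain_image) (rule adjoint_chain_axioms)
  have "omap (Adj_func F) X = omap F X" by (simp add: Adj_func_def)
  then show ?thesis
    using cocone_func_comp[OF functor_chain
        is_functor_Adj_func[OF K.O_category_axioms L.O_category_axioms F] cocone]
    by unfold_locales simp
qed

lemma locally_determined_image:
  assumes "adjoint_cocone K \<Delta> X c" and ld: "locally_determined K \<Delta> X c"
  shows "locally_determined L (func_comp (Adj_func F) \<Delta>) (omap F X) (\<lambda>n. amap (Adj_func F) (c n))"
proof -
  interpret c: adjoint_cocone K \<Delta> X c by fact
  interpret Fc: adjoint_cocone L "func_comp (Adj_func F) \<Delta>" "omap F X" "\<lambda>n. amap (Adj_func F) (c n)"
    by (rule adjoint_cocone_image) fact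
  have lub_id: "is_lub K X X (range (\<lambda>n. fst (c n) \<cdot>\<^bsub>K\<^esub> snd (c n))) (Ide K X)"
    and lub_leg: "is_lub K (c.D n) (c.D n) (range (\<lambda>i. c.r n (n + i) \<cdot>\<^bsub>K\<^esub> c.l n (n + i)))
      (snd (c n) \<cdot>\<^bsub>K\<^esub> fst (c n))" for n
    using ld by (auto simp: c.locally_determined_iff)
  have 1: "amap F (fst (c n) \<cdot>\<^bsub>K\<^esub> snd (c n)) = amap F (fst (c n)) \<cdot>\<^bsub>L\<^esub> amap F (snd (c n))"
    "amap F (snd (c n) \<cdot>\<^bsub>K\<^esub> fst (c n)) = amap F (snd (c n)) \<cdot>\<^bsub>L\<^esub> amap F (fst (c n))" for n
    using amap_Cmp[OF c.cr_Hom c.cl_Hom] amap_Cmp[OF c.cl_Hom c.cr_Hom] by auto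
  have 2: "amap F (c.r n (n + i) \<cdot>\<^bsub>K\<^esub> c.l n (n + i)) = amap F (c.r n (n + i)) \<cdot>\<^bsub>L\<^esub> amap F (c.l n (n + i))"
    for n i using amap_Cmp[OF c.l_Hom c.r_Hom] by simp
  \<comment> \<open>Local continuity concerns omega-chains only, so both families must be seen to
    increase before their suprema can be transported.\<close>
  have chain_id: "omega_chain_in K X X (\<lambda>n. fst (c n) \<cdot>\<^bsub>K\<^esub> snd (c n))"
    by (rule K.omega_chain_inI) (simp add: c.mediating_mono c.adjoint_cocone_axioms)
  have chain_leg: "omega_chain_in K (c.D n) (c.D n) (\<lambda>i. c.r n (n + i) \<cdot>\<^bsub>K\<^esub> c.l n (n + i))" for n
    by (rule K.omega_chain_inI) (simp add: c.r_l_mono)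
  show ?thesis
    using amap_lub[OF chain_id lub_id] amap_lub[OF chain_leg lub_leg]
    unfolding Fc.locally_determined_iff by (simp add: 1 2 amap_Ide func_comp_def Adj_func_def)
qed

lemma locally_determined_imp_preserves_colimit:
  assumes "adjoint_cocone K \<Delta> X c" "locally_determined K \<Delta> X c"
  shows "preserves_colimit F L \<Delta> X c"
proof -
  interpret Fc: adjoint_cocone L "func_comp (Adj_func F) \<Delta>" "omap F X" "\<lambda>n. amap (Adj_func F) (c n)"
    by (rule adjoint_cocone_image) fact
  show ?thesis
    unfolding preserves_colimit_def
    by (rule Fc.locally_determined_imp_colimiting[OF Fc.cocone locally_determined_image[OF assms]])
qed

end

section \<open>Invariance of local determination among colimits\<close>

context adjoint_chain
begin

text \<open>Uniqueness of mediating morphisms makes the apexes isomorphic in \<open>Adj K\<close>,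
  and the right part of an isomorphism inverts its left part. Conjugation by it carries the first
  supremum over, and it cancels from \<open>snd (c n) \<cdot> fst (c n)\<close>.\<close>

lemma colimiting_locally_determined_transfer:
  assumes X: "colimiting nat_cat (Adj K) \<Delta> X c" and Y: "colimiting nat_cat (Adj K) \<Delta> Y d"
    and ld: "locally_determined K \<Delta> Y d"
  shows "locally_determined K \<Delta> X c"
proof -
  interpret c: adjoint_cocone K \<Delta> X c
    using X by unfold_locales (simp add: colimiting_def)
  interpret d: adjoint_cocone K \<Delta> Y d
    using Y by unfold_locales (simp add: colimiting_def)
  interpret Adj: category "Adj K" by (rule category_Adj)
  obtain h where h: "h \<in> Hom (Adj K) Y X" "\<And>j. h \<cdot>\<^bsub>Adj K\<^esub> d j = c j"
    using Y c.cocone unfolding colimiting_def Ob_nat_cat by blast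
  obtain k where k: "k \<in> Hom (Adj K) X Y" "\<And>j. k \<cdot>\<^bsub>Adj K\<^esub> c j = d j"
    using X d.cocone unfolding colimiting_def Ob_nat_cat by blast
  have uniq: "g = g'"
    if "colimiting nat_cat (Adj K) \<Delta> Z e" "g \<in> Hom (Adj K) Z Z" "g' \<in> Hom (Adj K) Z Z"
      "\<And>j. g \<cdot>\<^bsub>Adj K\<^esub> e j = e j" "\<And>j. g' \<cdot>\<^bsub>Adj K\<^esub> e j = e j" for Z e g g'
    using that unfolding colimiting_def Ob_nat_cat by blast
  have hk: "h \<cdot>\<^bsub>Adj K\<^esub> k = Ide (Adj K) X"
  proof (rule uniq[OF X Adj_Cmp_Hom[OF k(1) h(1)] Adj.Ide_Hom])
    show "X \<in> Ob (Adj K)" by (simp add: Ob_Adj)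
    show "(h \<cdot>\<^bsub>Adj K\<^esub> k) \<cdot>\<^bsub>Adj K\<^esub> c j = c j" for j
      by (simp add: Adj.Cmp_assoc[OF c.Adj_leg k(1) h(1)] k(2) h(2))
    show "Ide (Adj K) X \<cdot>\<^bsub>Adj K\<^esub> c j = c j" for j
      by (rule Adj.Cmp_Ide_left[OF c.Adj_leg])
  qed
  have kh: "k \<cdot>\<^bsub>Adj K\<^esub> h = Ide (Adj K) Y"
  proof (rule uniq[OF Y Adj_Cmp_Hom[OF h(1) k(1)] Adj.Ide_Hom])
    show "Y \<in> Ob (Adj K)" by (simp add: Ob_Adj)
    show "(k \<cdot>\<^bsub>Adj K\<^esub> h) \<cdot>\<^bsub>Adj K\<^esub> d j = d j" for j
      by (simp add: Adj.Cmp_assoc[OF d.Adj_leg h(1) k(1)] k(2) h(2))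
    show "Ide (Adj K) Y \<cdot>\<^bsub>Adj K\<^esub> d j = d j" for j
      by (rule Adj.Cmp_Ide_left[OF d.Adj_leg])
  qed
  note hH = AdjD(1,2)[OF h(1)] and kH = AdjD(1,2)[OF k(1)]
  note [simp] = HomD(1-3)[OF hH(1)] HomD(1-3)[OF hH(2)] HomD(1-3)[OF kH(1)] HomD(1-3)[OF kH(2)]
  have inv: "fst h \<cdot> fst k = Ide K X" "fst k \<cdot> fst h = Ide K Y"
    using hk kh by (simp_all add: Cmp_Adj Ide_Adj)
  \<comment> \<open>The unit and the counit of \<open>h\<close>, composed with the inverse
    \<open>fst k\<close> of \<open>fst h\<close>, yield one inequality each.\<close>
  have "snd h = fst k"
  proof (rule hle_antisym)
    have "hle X Y (fst k) ((snd h \<cdot> fst h) \<cdot> fst k)"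
      using hle_Cmp_left[OF AdjD(4)[OF h(1)] kH(1)] by simp
    then show "hle X Y (fst k) (snd h)" by (simp add: inv)
    have "hle X Y (fst k \<cdot> (fst h \<cdot> snd h)) (fst k)"
      using hle_Cmp_right[OF AdjD(3)[OF h(1)] kH(1)] by simp
    also have "fst k \<cdot> (fst h \<cdot> snd h) = (fst k \<cdot> fst h) \<cdot> snd h" by simp
    also have "\<dots> = snd h" unfolding inv by simp
    finally show "hle X Y (snd h) (fst k)" .
  qed
  then have iso: "fst h \<cdot> snd h = Ide K X" "snd h \<cdot> fst h = Ide K Y" using inv by simp_all
  have cd: "fst (c n) = fst h \<cdot> fst (d n)" "snd (c n) = snd (d n) \<cdot> snd h" for n
    using h(2)[of n] by (metis Cmp_Adj fst_conv snd_conv)+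
  have lub_id: "is_lub K Y Y (range (\<lambda>n. fst (d n) \<cdot> snd (d n))) (Ide K Y)"
    and lub_leg: "is_lub K (D n) (D n) (range (\<lambda>i. r n (n + i) \<cdot> l n (n + i))) (snd (d n) \<cdot> fst (d n))" for n
    using ld by (auto simp: d.locally_determined_iff)
  have chain: "omega_chain_in K Y Y (\<lambda>n. fst (d n) \<cdot> snd (d n))"
    by (rule omega_chain_inI) (simp add: mediating_mono d.adjoint_cocone_axioms)
  have chain': "omega_chain_in K Y X (\<lambda>n. fst h \<cdot> (fst (d n) \<cdot> snd (d n)))"
    using hle_Cmp_right[OF omega_chain_in_hle[OF chain] hH(1)] by (intro omega_chain_inI) simp
  have "is_lub K X X (range (\<lambda>n. (fst h \<cdot> (fst (d n) \<cdot> snd (d n))) \<cdot> snd h)) ((fst h \<cdot> Ide K Y) \<cdot> snd h)"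
    by (rule Cmp_lub_left[OF chain' Cmp_lub_right[OF hH(1) chain lub_id] hH(2)])
  then have "is_lub K X X (range (\<lambda>n. fst (c n) \<cdot> snd (c n))) (Ide K X)"
    by (simp add: cd iso)
  moreover have "snd (c n) \<cdot> fst (c n) = snd (d n) \<cdot> fst (d n)" for n
  proof -
    have "snd (c n) \<cdot> fst (c n) = snd (d n) \<cdot> ((snd h \<cdot> fst h) \<cdot> fst (d n))" by (simp add: cd)
    then show ?thesis by (simp add: iso)
  qed
  ultimately show ?thesis using lub_leg by (simp add: c.locally_determined_iff)
qed

end

section \<open>The O-category of omega-cpos\<close>

definition poset_lub :: "'a poset_ob \<Rightarrow> 'a set \<Rightarrow> 'a \<Rightarrow> bool" where
  "poset_lub P S x \<longleftrightarrow> x \<in> fst P \<and> (\<forall>s \<in> S. snd P s x)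
    \<and> (\<forall>y \<in> fst P. (\<forall>s \<in> S. snd P s y) \<longrightarrow> snd P x y)"

definition poset_chain :: "'a poset_ob \<Rightarrow> (nat \<Rightarrow> 'a) \<Rightarrow> bool" where
  "poset_chain P s \<longleftrightarrow> (\<forall>n. s n \<in> fst P) \<and> (\<forall>n. snd P (s n) (s (Suc n)))"

text \<open>No least element is demanded, since hom-sets of an O-category may lack one, or be
  empty.\<close>

definition omega_cpo :: "'a poset_ob \<Rightarrow> bool" where
  "omega_cpo P \<longleftrightarrow> reflp_on (fst P) (snd P) \<and> transp_on (fst P) (snd P) \<and> antisymp_on (fst P) (snd P)
    \<and> (\<forall>s. poset_chain P s \<longrightarrow> (\<exists>x. poset_lub P (range s) x))"

definition omega_cont :: "'a poset_ob \<Rightarrow> 'a poset_ob \<Rightarrow> ('a \<Rightarrow> 'a) \<Rightarrow> bool" where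
  "omega_cont P Q f \<longleftrightarrow> f \<in> fst P \<rightarrow> fst Q
    \<and> (\<forall>x \<in> fst P. \<forall>y \<in> fst P. snd P x y \<longrightarrow> snd Q (f x) (f y))
    \<and> (\<forall>s x. poset_chain P s \<and> poset_lub P (range s) x \<longrightarrow> poset_lub Q (range (\<lambda>n. f (s n))) (f x))"

text \<open>Extensional functions are determined by their values on the carrier; arrows differing
  elsewhere would break antisymmetry. Hence also \<open>compose\<close> and
  \<open>restrict id\<close>. The order of an object is unconstrained off its carrier, so an
  omega-cpo may occur in several isomorphic copies, which is harmless.\<close>

definition CPO :: "('a poset_ob, 'a poset_arr) ocat" where
  "CPO = \<lparr> Ob = Collect omega_cpo,
     Arr = {(P, Q, f). omega_cpo P \<and> omega_cpo Q \<and> omega_cont P Q f \<and> f \<in> extensional (fst P)},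
     Dom = fst, Cod = (\<lambda>f. fst (snd f)),
     Ide = (\<lambda>P. (P, P, restrict id (fst P))),
     Cmp = (\<lambda>g f. (fst f, fst (snd g), compose (fst (fst f)) (snd (snd g)) (snd (snd f)))),
     Le = (\<lambda>f g. \<forall>x \<in> fst (fst f). snd (fst (snd f)) (snd (snd f) x) (snd (snd g) x)) \<rparr>"

lemma Hom_CPO: "h \<in> Hom CPO P Q \<longleftrightarrow> (\<exists>f. h = (P, Q, f) \<and> omega_cpo P \<and> omega_cpo Q \<and>
    omega_cont P Q f \<and> f \<in> extensional (fst P))"
  by (cases h) (auto simp: Hom_def CPO_def)

lemma Hom_CPO_D:
  assumes "h \<in> Hom CPO P Q"
  shows "h = (P, Q, snd (snd h))" "omega_cpo P" "omega_cpo Q" "omega_cont P Q (snd (snd h))"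
  using assms by (auto simp: Hom_CPO)

lemma Le_CPO: "(P, Q, f) \<sqsubseteq>\<^bsub>CPO\<^esub> g \<longleftrightarrow> (\<forall>x \<in> fst P. snd Q (f x) (snd (snd g) x))"
  by (simp add: CPO_def)

lemma Le_CPO_iff:
  "f \<in> Hom CPO P Q \<Longrightarrow> f \<sqsubseteq>\<^bsub>CPO\<^esub> g \<longleftrightarrow> (\<forall>x \<in> fst P. snd Q (snd (snd f) x) (snd (snd g) x))"
  by (auto simp: Hom_CPO Le_CPO)

lemma Cmp_CPO: "(Q', R, g) \<cdot>\<^bsub>CPO\<^esub> (P, Q, f) = (P, R, compose (fst P) g f)"
  by (simp add: CPO_def)

lemma app_Cmp_CPO:
  "f \<in> Hom CPO P Q \<Longrightarrow> g \<in> Hom CPO Q R \<Longrightarrow> x \<in> fst P \<Longrightarrow>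
    snd (snd (g \<cdot>\<^bsub>CPO\<^esub> f)) x = snd (snd g) (snd (snd f) x)"
  by (auto simp: Hom_CPO Cmp_CPO compose_eq)

lemma Ide_CPO: "Ide CPO P = (P, P, restrict id (fst P))"
  by (simp add: CPO_def)

lemma Ob_CPO: "Ob CPO = Collect omega_cpo"
  by (simp add: CPO_def)

lemma omega_cpo_refl: "omega_cpo P \<Longrightarrow> x \<in> fst P \<Longrightarrow> snd P x x"
  by (auto simp: omega_cpo_def dest: reflp_onD)

lemma omega_cpo_trans:
  "omega_cpo P \<Longrightarrow> snd P x y \<Longrightarrow> snd P y z \<Longrightarrow> x \<in> fst P \<Longrightarrow> y \<in> fst P \<Longrightarrow> z \<in> fst P \<Longrightarrow> snd P x z"
  unfolding omega_cpo_def by (meson transp_onD)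

lemma omega_cpo_antisym:
  "omega_cpo P \<Longrightarrow> snd P x y \<Longrightarrow> snd P y x \<Longrightarrow> x \<in> fst P \<Longrightarrow> y \<in> fst P \<Longrightarrow> x = y"
  unfolding omega_cpo_def by (meson antisymp_onD)

lemma poset_lub_unique: "omega_cpo P \<Longrightarrow> poset_lub P S x \<Longrightarrow> poset_lub P S y \<Longrightarrow> x = y"
  unfolding poset_lub_def by (meson omega_cpo_antisym)

lemma omega_cont_mem: "omega_cont P Q f \<Longrightarrow> x \<in> fst P \<Longrightarrow> f x \<in> fst Q"
  by (auto simp: omega_cont_def)

lemma omega_cont_mono:
  "omega_cont P Q f \<Longrightarrow> snd P x y \<Longrightarrow> x \<in> fst P \<Longrightarrow> y \<in> fst P \<Longrightarrow> snd Q (f x) (f y)"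
  by (auto simp: omega_cont_def)

lemma omega_cont_lub:
  "omega_cont P Q f \<Longrightarrow> poset_chain P s \<Longrightarrow> poset_lub P (range s) x \<Longrightarrow> poset_lub Q (range (\<lambda>n. f (s n))) (f x)"
  by (auto simp: omega_cont_def)

lemma poset_chain_mem: "poset_chain P s \<Longrightarrow> s n \<in> fst P"
  by (simp add: poset_chain_def)

lemma poset_lub_mem: "poset_lub P S x \<Longrightarrow> x \<in> fst P"
  by (simp add: poset_lub_def)

lemma omega_cont_chain: "omega_cont P Q f \<Longrightarrow> poset_chain P s \<Longrightarrow> poset_chain Q (\<lambda>n. f (s n))"
  by (auto simp: omega_cont_def poset_chain_def)

text \<open>Continuity sees only values on the carrier, so it can be shown for a plain lambda term
  and then transferred to its \<open>restrict\<close> form.\<close>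

lemma omega_cont_cong:
  assumes "\<And>x. x \<in> fst P \<Longrightarrow> f x = g x" "omega_cont P Q f"
  shows "omega_cont P Q g"
proof -
  have "poset_lub Q (range (\<lambda>n. g (s n))) (g x)"
    if "poset_chain P s" "poset_lub P (range s) x" for s x
    using omega_cont_lub[OF assms(2) that] poset_chain_mem[OF that(1)] poset_lub_mem[OF that(2)]
    by (simp add: assms(1))
  moreover have "g \<in> fst P \<rightarrow> fst Q"
    using omega_cont_mem[OF assms(2)] by (simp add: assms(1)[symmetric])
  moreover have "snd Q (g x) (g y)" if "x \<in> fst P" "y \<in> fst P" "snd P x y" for x y
    using omega_cont_mono[OF assms(2) that(3,1,2)] that by (simp add: assms(1))
  ultimately show ?thesis unfolding omega_cont_def by blast
qed

lemma omega_cont_id: "omega_cont P P (restrict id (fst P))"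
  by (rule omega_cont_cong[of _ id]) (auto simp: omega_cont_def)

lemma omega_cont_compose:
  assumes f: "omega_cont P Q f" and g: "omega_cont Q R g"
  shows "omega_cont P R (compose (fst P) g f)"
proof (rule omega_cont_cong)
  show "(\<lambda>x. g (f x)) x = compose (fst P) g f x" if "x \<in> fst P" for x
    using that by (simp add: compose_eq)
  show "omega_cont P R (\<lambda>x. g (f x))"
    unfolding omega_cont_def
    using omega_cont_mem[OF f] omega_cont_mem[OF g] omega_cont_mono[OF f] omega_cont_mono[OF g]
      omega_cont_lub[OF g omega_cont_chain[OF f] omega_cont_lub[OF f]] by auto
qed

text \<open>An interchange of suprema, over \<open>n\<close> and over a chain in \<open>P\<close>:
  bounds are tested against one \<open>f n\<close> at a time.\<close>

lemma omega_cont_pointwise_lub: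
  assumes Q: "omega_cpo Q" and f: "\<And>n. omega_cont P Q (f n)"
    and g: "\<And>x. x \<in> fst P \<Longrightarrow> poset_lub Q (range (\<lambda>n. f n x)) (g x)"
  shows "omega_cont P Q g"
proof -
  have mem: "g x \<in> fst Q" and upper: "snd Q (f n x) (g x)" if "x \<in> fst P" for x n
    using g[OF that] by (auto simp: poset_lub_def)
  have least: "snd Q (g x) y" if "x \<in> fst P" "y \<in> fst Q" "\<And>n. snd Q (f n x) y" for x y
    using g[OF that(1)] that(2,3) by (auto simp: poset_lub_def)
  have mono: "snd Q (g x) (g y)" if "x \<in> fst P" "y \<in> fst P" "snd P x y" for x y
    using omega_cpo_trans[OF Q omega_cont_mono[OF f that(3,1,2)] upper[OF that(2)]]
      omega_cont_mem[OF f] that mem by (intro least) auto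
  moreover have "poset_lub Q (range (\<lambda>k. g (s k))) (g x)"
    if s: "poset_chain P s" and x: "poset_lub P (range s) x" for s x
    unfolding poset_lub_def
  proof (intro conjI ballI impI)
    have xP: "x \<in> fst P" and sP: "s k \<in> fst P" and sx: "snd P (s k) x" for k
      using s x by (auto simp: poset_lub_def poset_chain_def)
    show "g x \<in> fst Q" by (rule mem[OF xP])
    show "snd Q y (g x)" if "y \<in> range (\<lambda>k. g (s k))" for y
      using that mono[OF sP xP sx] by auto
    fix z assume z: "z \<in> fst Q" and ub: "\<forall>y \<in> range (\<lambda>k. g (s k)). snd Q y z"
    show "snd Q (g x) z"
    proof (rule least[OF xP z])
      fix n
      \<comment> \<open>Since \<open>f n (s k)\<close> lies below \<open>g (s k)\<close>, it lies
        below \<open>z\<close>; continuity of this single \<open>f n\<close> carries the bound to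
        \<open>x\<close>.\<close>
      have "snd Q (f n (s k)) z" for k
        using ub by (intro omega_cpo_trans[OF Q upper[OF sP[of k], of n]])
          (auto simp: z mem[OF sP] omega_cont_mem[OF f sP])
      then show "snd Q (f n x) z"
        using omega_cont_lub[OF f s x, of n] z by (auto simp: poset_lub_def)
    qed
  qed
  ultimately show ?thesis using mem by (auto simp: omega_cont_def)
qed

lemma is_lub_CPO_pointwiseI:
  assumes g: "g \<in> Hom CPO P Q" and S: "S \<subseteq> Hom CPO P Q"
    and lub: "\<And>x. x \<in> fst P \<Longrightarrow> poset_lub Q ((\<lambda>f. snd (snd f) x) ` S) (snd (snd g) x)"
  shows "is_lub CPO P Q S g"
  unfolding is_lub_def
proof (intro conjI ballI impI)
  show "g \<in> Hom CPO P Q" by fact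
  show "f \<sqsubseteq>\<^bsub>CPO\<^esub> g" if f: "f \<in> S" for f
    using lub f by (simp add: Le_CPO_iff[OF subsetD[OF S f]] poset_lub_def)
  show "g \<sqsubseteq>\<^bsub>CPO\<^esub> h"
    if h: "h \<in> Hom CPO P Q" and ub: "\<forall>f \<in> S. f \<sqsubseteq>\<^bsub>CPO\<^esub> h" for h
    unfolding Le_CPO_iff[OF g]
  proof (intro ballI)
    fix x assume x: "x \<in> fst P"
    have "snd (snd h) x \<in> fst Q" using omega_cont_mem[OF Hom_CPO_D(4)[OF h] x] .
    moreover have "snd Q (snd (snd f) x) (snd (snd h) x)" if f: "f \<in> S" for f
      using bspec[OF ub f] x by (simp add: Le_CPO_iff[OF subsetD[OF S f]])
    ultimately show "snd Q (snd (snd g) x) (snd (snd h) x)"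
      using lub[OF x] by (auto simp: poset_lub_def)
  qed
qed

lemma CPO_chain_pointwise:
  assumes "omega_chain_in CPO P Q fs" "x \<in> fst P"
  shows "poset_chain Q (\<lambda>n. snd (snd (fs n)) x)"
proof -
  have 1: "fs n \<in> Hom CPO P Q" "fs n \<sqsubseteq>\<^bsub>CPO\<^esub> fs (Suc n)" for n
    using assms by (auto simp: omega_chain_in_def)
  note 2 = Hom_CPO_D(1)[OF 1(1)]
  have "snd Q (snd (snd (fs n)) x) (snd (snd (fs (Suc n))) x)" for n
    using 1(2)[of n] assms(2) by (subst (asm) 2) (auto simp: Le_CPO)
  moreover have "snd (snd (fs n)) x \<in> fst Q" for n
    using 1(1)[of n] assms(2) by (auto simp: Hom_CPO omega_cont_mem)
  ultimately show ?thesis by (simp add: poset_chain_def)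
qed

lemma CPO_lub_exists_pointwise:
  assumes fs: "omega_chain_in CPO P Q fs"
  obtains g where "(P, Q, g) \<in> Hom CPO P Q" "is_lub CPO P Q (range fs) (P, Q, g)"
    "\<And>x. x \<in> fst P \<Longrightarrow> poset_lub Q (range (\<lambda>n. snd (snd (fs n)) x)) (g x)"
proof -
  have H: "fs n \<in> Hom CPO P Q" for n
    using fs by (auto simp: omega_chain_in_def)
  note PQ = Hom_CPO_D(2,3)[OF H] and cont = Hom_CPO_D(4)[OF H]
  \<comment> \<open>Lubs in \<open>Q\<close> are unique, so the choice is no real choice;
    \<open>restrict\<close> makes \<open>g\<close> an admissible arrow.\<close>
  define g where "g = restrict (\<lambda>x. SOME y. poset_lub Q (range (\<lambda>n. snd (snd (fs n)) x)) y) (fst P)"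
  have g: "poset_lub Q (range (\<lambda>n. snd (snd (fs n)) x)) (g x)" if "x \<in> fst P" for x
    using PQ(2) CPO_chain_pointwise[OF fs that] that unfolding omega_cpo_def
    by (simp add: g_def) (meson someI_ex)
  have gH: "(P, Q, g) \<in> Hom CPO P Q"
    using PQ omega_cont_pointwise_lub[OF PQ(2) cont g] by (simp add: Hom_CPO) (simp add: g_def)
  moreover have "is_lub CPO P Q (range fs) (P, Q, g)"
    using gH by (rule is_lub_CPO_pointwiseI) (use H g in \<open>auto simp: image_image\<close>)
  ultimately show ?thesis using that g by blast
qed

lemma category_CPO: "category CPO"
proof
  fix f :: "'a poset_arr"
  assume "f \<in> Arr CPO"
  then show "Dom CPO f \<in> Ob CPO" "Cod CPO f \<in> Ob CPO" by (auto simp: CPO_def)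
next
  show "Ide CPO A \<in> Hom CPO A A" if "A \<in> Ob CPO" for A :: "'a poset_ob"
    using that by (simp add: Hom_CPO Ide_CPO Ob_CPO omega_cont_id)
  show "g \<cdot>\<^bsub>CPO\<^esub> f \<in> Hom CPO A D" if "f \<in> Hom CPO A B" "g \<in> Hom CPO B D"
    for f g and A B D :: "'a poset_ob"
    using that by (auto simp: Hom_CPO Cmp_CPO omega_cont_compose)
  show "Ide CPO B \<cdot>\<^bsub>CPO\<^esub> f = f" if "f \<in> Hom CPO A B" for f and A B :: "'a poset_ob"
    using that by (auto simp: Hom_CPO Cmp_CPO Ide_CPO omega_cont_mem compose_def extensional_def fun_eq_iff)
  show "f \<cdot>\<^bsub>CPO\<^esub> Ide CPO A = f" if "f \<in> Hom CPO A B" for f and A B :: "'a poset_ob"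
    using that by (auto simp: Hom_CPO Cmp_CPO Ide_CPO compose_def extensional_def fun_eq_iff)
  show "(h \<cdot>\<^bsub>CPO\<^esub> g) \<cdot>\<^bsub>CPO\<^esub> f = h \<cdot>\<^bsub>CPO\<^esub> (g \<cdot>\<^bsub>CPO\<^esub> f)"
    if "f \<in> Hom CPO A B" "g \<in> Hom CPO B D" "h \<in> Hom CPO D E" for f g h and A B D E :: "'a poset_ob"
    using that by (auto simp: Hom_CPO Cmp_CPO omega_cont_mem compose_def fun_eq_iff)
qed

lemma CPO_antisym: "antisymp_on (Hom CPO P Q) (Le CPO)"
proof (rule antisymp_onI)
  fix f g assume "f \<in> Hom CPO P Q" "g \<in> Hom CPO P Q" and le: "f \<sqsubseteq>\<^bsub>CPO\<^esub> g" "g \<sqsubseteq>\<^bsub>CPO\<^esub> f"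
  then obtain f' g' where [simp]: "f = (P, Q, f')" "g = (P, Q, g')"
    and H: "omega_cpo Q" "omega_cont P Q f'" "omega_cont P Q g'"
      "f' \<in> extensional (fst P)" "g' \<in> extensional (fst P)"
    by (auto simp: Hom_CPO)
  have "f' = g'"
    by (rule extensionalityI[OF H(4,5)], rule omega_cpo_antisym[OF H(1)])
      (use le H in \<open>auto simp: Le_CPO omega_cont_mem\<close>)
  then show "f = g" by simp
qed

text \<open>Being least among continuous maps does not by itself control values. But the map of
  pointwise lubs is continuous and also least, so antisymmetry identifies the two.\<close>

lemma CPO_lub_pointwise:
  assumes "omega_chain_in CPO P Q fs" "is_lub CPO P Q (range fs) g" "x \<in> fst P"
  shows "poset_lub Q (range (\<lambda>n. snd (snd (fs n)) x)) (snd (snd g) x)"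
proof -
  obtain h where h: "(P, Q, h) \<in> Hom CPO P Q" "is_lub CPO P Q (range fs) (P, Q, h)"
    "poset_lub Q (range (\<lambda>n. snd (snd (fs n)) x)) (h x)"
    using CPO_lub_exists_pointwise[OF assms(1)] assms(3) by metis
  have "g = (P, Q, h)"
    using h(1,2) assms(2) antisymp_onD[OF CPO_antisym] unfolding is_lub_def by metis
  then show ?thesis using h(3) by simp
qed

lemma O_category_CPO: "O_category CPO"
proof (intro O_category.intro O_category_axioms.intro category_CPO CPO_antisym)
  fix A B C :: "'a poset_ob"
  show "reflp_on (Hom CPO A B) (Le CPO)"
  proof (rule reflp_onI)
    fix f assume f: "f \<in> Hom CPO A B"
    show "f \<sqsubseteq>\<^bsub>CPO\<^esub> f"
      using omega_cpo_refl[OF Hom_CPO_D(3)[OF f] omega_cont_mem[OF Hom_CPO_D(4)[OF f]]]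
      by (simp add: Le_CPO_iff[OF f])
  qed
  show "transp_on (Hom CPO A B) (Le CPO)"
  proof (rule transp_onI)
    fix f g h assume H: "f \<in> Hom CPO A B" "g \<in> Hom CPO A B" "h \<in> Hom CPO A B"
      and le: "f \<sqsubseteq>\<^bsub>CPO\<^esub> g" "g \<sqsubseteq>\<^bsub>CPO\<^esub> h"
    then show "f \<sqsubseteq>\<^bsub>CPO\<^esub> h"
      using omega_cpo_trans[OF Hom_CPO_D(3)[OF H(1)]] omega_cont_mem[OF Hom_CPO_D(4)[OF H(1)]]
        omega_cont_mem[OF Hom_CPO_D(4)[OF H(2)]] omega_cont_mem[OF Hom_CPO_D(4)[OF H(3)]]
      unfolding Le_CPO_iff[OF H(1)] Le_CPO_iff[OF H(2)] by blast
  qed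
  show "\<exists>f. is_lub CPO A B (range fs) f" if "omega_chain_in CPO A B fs" for fs
    using CPO_lub_exists_pointwise[OF that] by blast
  show "g \<cdot>\<^bsub>CPO\<^esub> f \<sqsubseteq>\<^bsub>CPO\<^esub> g' \<cdot>\<^bsub>CPO\<^esub> f"
    if "g \<in> Hom CPO B C" "g' \<in> Hom CPO B C" "f \<in> Hom CPO A B" "g \<sqsubseteq>\<^bsub>CPO\<^esub> g'" for g g' f
    using that by (auto simp: Hom_CPO Le_CPO Cmp_CPO compose_eq omega_cont_mem)
  show "g \<cdot>\<^bsub>CPO\<^esub> f \<sqsubseteq>\<^bsub>CPO\<^esub> g \<cdot>\<^bsub>CPO\<^esub> f'"
    if "g \<in> Hom CPO B C" "f \<in> Hom CPO A B" "f' \<in> Hom CPO A B" "f \<sqsubseteq>\<^bsub>CPO\<^esub> f'" for g f f'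
    using that(4) omega_cont_mono[OF Hom_CPO_D(4)[OF that(1)]] omega_cont_mem[OF Hom_CPO_D(4)[OF that(2)]]
      omega_cont_mem[OF Hom_CPO_D(4)[OF that(3)]]
    by (simp add: Le_CPO_iff[OF that(2)] Le_CPO_iff[OF category.Cmp_Hom[OF category_CPO that(2,1)]]
        app_Cmp_CPO[OF that(2,1)] app_Cmp_CPO[OF that(3,1)])
  show "is_lub CPO A C (range (\<lambda>n. gs n \<cdot>\<^bsub>CPO\<^esub> f)) (g \<cdot>\<^bsub>CPO\<^esub> f)"
    if gs: "omega_chain_in CPO B C gs" and g: "is_lub CPO B C (range gs) g" and f: "f \<in> Hom CPO A B"
    for gs g f
  proof -
    have H: "g \<in> Hom CPO B C" "gs n \<in> Hom CPO B C" for n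
      using gs g by (auto simp: is_lub_def omega_chain_in_def)
    have H': "g \<cdot>\<^bsub>CPO\<^esub> f \<in> Hom CPO A C" "gs n \<cdot>\<^bsub>CPO\<^esub> f \<in> Hom CPO A C" for n
      using category.Cmp_Hom[OF category_CPO f] H by auto
    have "snd (snd f) x \<in> fst B" if "x \<in> fst A" for x
      using omega_cont_mem[OF Hom_CPO_D(4)[OF f] that] .
    from CPO_lub_pointwise[OF gs g this] show ?thesis
      using H' by (intro is_lub_CPO_pointwiseI)
        (auto simp: image_image app_Cmp_CPO[OF f H(1)] app_Cmp_CPO[OF f H(2)])
  qed
  show "is_lub CPO A C (range (\<lambda>n. g \<cdot>\<^bsub>CPO\<^esub> fs n)) (g \<cdot>\<^bsub>CPO\<^esub> f)"
    if g: "g \<in> Hom CPO B C" and fs: "omega_chain_in CPO A B fs" and f: "is_lub CPO A B (range fs) f"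
    for g fs f
  proof -
    have H: "f \<in> Hom CPO A B" "fs n \<in> Hom CPO A B" for n
      using fs f by (auto simp: is_lub_def omega_chain_in_def)
    have H': "g \<cdot>\<^bsub>CPO\<^esub> f \<in> Hom CPO A C" "g \<cdot>\<^bsub>CPO\<^esub> fs n \<in> Hom CPO A C" for n
      using category.Cmp_Hom[OF category_CPO _ g] H by auto
    from omega_cont_lub[OF Hom_CPO_D(4)[OF g] CPO_chain_pointwise[OF fs] CPO_lub_pointwise[OF fs f]]
    show ?thesis
      using H' by (intro is_lub_CPO_pointwiseI)
        (auto simp: image_image app_Cmp_CPO[OF H(1) g] app_Cmp_CPO[OF H(2) g])
  qed
qed

lemma CPO_arr_eqI:
  assumes "f \<in> Hom CPO P Q" "g \<in> Hom CPO P Q" "\<And>x. x \<in> fst P \<Longrightarrow> snd (snd f) x = snd (snd g) x"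
  shows "f = g"
proof -
  obtain f' g' where [simp]: "f = (P, Q, f')" "g = (P, Q, g')"
    and ext: "f' \<in> extensional (fst P)" "g' \<in> extensional (fst P)"
    using assms(1,2) by (auto simp: Hom_CPO)
  have "f' = g'" using extensionalityI[OF ext] assms(3) by simp
  then show ?thesis by simp
qed

lemma app_Ide_CPO: "x \<in> fst P \<Longrightarrow> snd (snd (Ide CPO P)) x = x"
  by (simp add: Ide_CPO)

section \<open>Representable functors\<close>

context O_category
begin

text \<open>Arrows are encoded as constant sequences, so that the posets \<open>Hom K A X\<close> and their limit
  along a chain have the same carrier type.\<close>

definition hom_poset :: "'o \<Rightarrow> 'o \<Rightarrow> (nat \<Rightarrow> 'm) poset_ob" where
  "hom_poset A X = ({s. s 0 \<in> Hom K A X \<and> (\<forall>n. s n = s 0)}, \<lambda>s t. s 0 \<sqsubseteq> t 0)"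

definition hom_functor :: "'o \<Rightarrow> ('o, 'm, (nat \<Rightarrow> 'm) poset_ob, (nat \<Rightarrow> 'm) poset_arr) func" where
  "hom_functor A = \<lparr> omap = hom_poset A,
     amap = (\<lambda>f. (hom_poset A (Dom K f), hom_poset A (Cod K f),
       restrict (\<lambda>s _. f \<cdot> s 0) (fst (hom_poset A (Dom K f))))) \<rparr>"

lemma hom_poset_mem: "s \<in> fst (hom_poset A X) \<longleftrightarrow> s 0 \<in> Hom K A X \<and> (\<forall>n. s n = s 0)"
  by (simp add: hom_poset_def)

lemma hom_poset_le: "snd (hom_poset A X) s t \<longleftrightarrow> s 0 \<sqsubseteq> t 0"
  by (simp add: hom_poset_def)

text \<open>Constant sequences correspond to arrows, so every supremum in a represented poset
  reduces to one in \<open>K\<close>.\<close>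

lemma poset_lub_hom_iff:
  "poset_lub (hom_poset A X) S x \<longleftrightarrow> (\<forall>n. x n = x 0) \<and> is_lub K A X ((\<lambda>s. s 0) ` S) (x 0)"
proof -
  have "(\<forall>y \<in> fst (hom_poset A X). P (y 0)) \<longleftrightarrow> (\<forall>y \<in> Hom K A X. P y)" for P
  proof (intro iffI ballI)
    fix y assume *: "\<forall>y \<in> fst (hom_poset A X). P (y 0)" and y: "y \<in> Hom K A X"
    have "(\<lambda>_. y) \<in> fst (hom_poset A X)" using y by (simp add: hom_poset_mem)
    with * show "P y" by fastforce
  qed (simp add: hom_poset_mem)
  from this[of "\<lambda>y. (\<forall>s\<in>S. s 0 \<sqsubseteq> y) \<longrightarrow> x 0 \<sqsubseteq> y"] show ?thesis
    unfolding poset_lub_def is_lub_def hom_poset_le by (auto simp: hom_poset_mem)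
qed

lemma poset_chain_hom:
  "poset_chain (hom_poset A X) s \<Longrightarrow> omega_chain_in K A X (\<lambda>n. s n 0)"
  by (simp add: poset_chain_def omega_chain_in_def hom_poset_mem hom_poset_le)

lemma omega_cpo_hom_poset: "omega_cpo (hom_poset A X)"
proof -
  have "reflp_on (fst (hom_poset A X)) (snd (hom_poset A X))"
    by (rule reflp_onI) (use reflp_onD[OF Le_refl] in \<open>unfold hom_poset_mem hom_poset_le, blast\<close>)
  moreover have "transp_on (fst (hom_poset A X)) (snd (hom_poset A X))"
    by (rule transp_onI) (use transp_onD[OF Le_trans] in \<open>unfold hom_poset_mem hom_poset_le, blast\<close>)
  moreover have "antisymp_on (fst (hom_poset A X)) (snd (hom_poset A X))"
    by (rule antisymp_onI)
      (use antisymp_onD[OF Le_antisym] in \<open>unfold hom_poset_mem hom_poset_le fun_eq_iff, metis\<close>)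
  moreover have "\<exists>x. poset_lub (hom_poset A X) (range s) x" if s: "poset_chain (hom_poset A X) s" for s
  proof -
    obtain f where "is_lub K A X (range (\<lambda>n. s n 0)) f"
      using lub_exists[OF poset_chain_hom[OF s]] by blast
    then have "poset_lub (hom_poset A X) (range s) (\<lambda>_. f)"
      by (simp add: poset_lub_hom_iff image_image)
    then show ?thesis by blast
  qed
  ultimately show ?thesis by (simp add: omega_cpo_def)
qed

text \<open>Continuity of composition in the right argument is spent here; continuity in the left
  argument later makes \<open>hom_functor A\<close> locally continuous.\<close>

lemma omega_cont_hom:
  assumes f: "f \<in> Hom K X Y"
  shows "omega_cont (hom_poset A X) (hom_poset A Y) (\<lambda>s _. f \<cdot> s 0)"
  unfolding omega_cont_def
proof (intro conjI allI impI ballI funcsetI)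
  show "(\<lambda>_. f \<cdot> s 0) \<in> fst (hom_poset A Y)" if "s \<in> fst (hom_poset A X)" for s
    using that Cmp_Hom[OF _ f] by (simp add: hom_poset_mem)
  show "snd (hom_poset A Y) (\<lambda>_. f \<cdot> s 0) (\<lambda>_. f \<cdot> t 0)"
    if "s \<in> fst (hom_poset A X)" "t \<in> fst (hom_poset A X)" "snd (hom_poset A X) s t" for s t
    using that Cmp_mono_right[OF f] unfolding hom_poset_mem hom_poset_le by blast
  show "poset_lub (hom_poset A Y) (range (\<lambda>n _. f \<cdot> s n 0)) (\<lambda>_. f \<cdot> x 0)"
    if "poset_chain (hom_poset A X) s \<and> poset_lub (hom_poset A X) (range s) x" for s x
    using that Cmp_lub_right[OF f poset_chain_hom] by (simp add: poset_lub_hom_iff image_image)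
qed

lemma omap_hom_functor: "omap (hom_functor A) X = hom_poset A X"
  by (simp add: hom_functor_def)

lemma amap_hom_functor: "f \<in> Hom K X Y \<Longrightarrow> amap (hom_functor A) f =
    (hom_poset A X, hom_poset A Y, restrict (\<lambda>s _. f \<cdot> s 0) (fst (hom_poset A X)))"
  using HomD by (simp add: hom_functor_def)

lemma app_hom_functor:
  "f \<in> Hom K X Y \<Longrightarrow> s \<in> fst (hom_poset A X) \<Longrightarrow> snd (snd (amap (hom_functor A) f)) s = (\<lambda>_. f \<cdot> s 0)"
  by (simp add: amap_hom_functor)

lemma hom_functor_Hom:
  assumes f: "f \<in> Hom K X Y"
  shows "amap (hom_functor A) f \<in> Hom CPO (hom_poset A X) (hom_poset A Y)"
proof -
  have "omega_cont (hom_poset A X) (hom_poset A Y) (restrict (\<lambda>s _. f \<cdot> s 0) (fst (hom_poset A X)))"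
    by (rule omega_cont_cong[OF _ omega_cont_hom[OF f]]) simp
  then show ?thesis by (simp add: amap_hom_functor[OF f] Hom_CPO omega_cpo_hom_poset)
qed

lemma is_functor_hom_functor: "is_functor K CPO (hom_functor A)"
  unfolding is_functor_def omap_hom_functor
proof (intro conjI ballI impI category_axioms category_CPO hom_functor_Hom)
  interpret CPO: O_category CPO by (rule O_category_CPO)
  show "hom_poset A X \<in> Ob CPO" for X by (simp add: Ob_CPO omega_cpo_hom_poset)
  then have Id: "Ide CPO (hom_poset A X) \<in> Hom CPO (hom_poset A X) (hom_poset A X)" for X
    by (rule CPO.Ide_Hom)
  show "amap (hom_functor A) (Ide K X) = Ide CPO (hom_poset A X)" if "X \<in> Ob K" for X
  proof (rule CPO_arr_eqI[OF hom_functor_Hom[OF Ide_Hom[OF that]] Id])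
    fix s assume s: "s \<in> fst (hom_poset A X)"
    then have "Ide K X \<cdot> s 0 = s 0" "\<forall>n. s n = s 0" using Cmp_Ide_left by (auto simp: hom_poset_mem)
    then show "snd (snd (amap (hom_functor A) (Ide K X))) s = snd (snd (Ide CPO (hom_poset A X))) s"
      by (simp add: app_hom_functor[OF Ide_Hom[OF that] s] app_Ide_CPO[OF s] fun_eq_iff) metis
  qed
  fix f g assume fg: "f \<in> Arr K" "g \<in> Arr K" "Dom K g = Cod K f"
  let ?X = "Dom K f" and ?Y = "Cod K f" and ?Z = "Cod K g"
  have f: "f \<in> Hom K ?X ?Y" and g: "g \<in> Hom K ?Y ?Z" using fg by (auto simp: Hom_def)
  show "amap (hom_functor A) (g \<cdot> f) = amap (hom_functor A) g \<cdot>\<^bsub>CPO\<^esub> amap (hom_functor A) f"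
  proof (rule CPO_arr_eqI[OF hom_functor_Hom[OF Cmp_Hom[OF f g]]
        CPO.Cmp_Hom[OF hom_functor_Hom[OF f] hom_functor_Hom[OF g]]])
    fix s assume s: "s \<in> fst (hom_poset A ?X)"
    then have fs: "(\<lambda>_. f \<cdot> s 0) \<in> fst (hom_poset A ?Y)" using Cmp_Hom[OF _ f] by (simp add: hom_poset_mem)
    have "s 0 \<in> Hom K A ?X" using s by (simp add: hom_poset_mem)
    from Cmp_assoc[OF this f g]
    show "snd (snd (amap (hom_functor A) (g \<cdot> f))) s
        = snd (snd (amap (hom_functor A) g \<cdot>\<^bsub>CPO\<^esub> amap (hom_functor A) f)) s"
      by (simp add: app_Cmp_CPO[OF hom_functor_Hom[OF f] hom_functor_Hom[OF g] s]
          app_hom_functor[OF Cmp_Hom[OF f g] s] app_hom_functor[OF f s] app_hom_functor[OF g fs])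
  qed
qed

lemma hom_functor_mono:
  assumes "f \<in> Hom K X Y" "g \<in> Hom K X Y" "f \<sqsubseteq> g"
  shows "amap (hom_functor A) f \<sqsubseteq>\<^bsub>CPO\<^esub> amap (hom_functor A) g"
  unfolding Le_CPO_iff[OF hom_functor_Hom[OF assms(1)]]
  using assms Cmp_mono_left by (auto simp: app_hom_functor hom_poset_mem hom_poset_le)

lemma locally_continuous_hom_functor: "locally_continuous K CPO (hom_functor A)"
  unfolding locally_continuous_def
proof (intro conjI ballI allI impI is_functor_hom_functor)
  show "amap (hom_functor A) f \<sqsubseteq>\<^bsub>CPO\<^esub> amap (hom_functor A) g"
    if "f \<in> Hom K X Y" "g \<in> Hom K X Y" "f \<sqsubseteq> g" for X Y f g
    using that by (rule hom_functor_mono)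
  fix X Y fs f
  assume *: "omega_chain_in K X Y fs \<and> is_lub K X Y (range fs) f"
  then have f: "f \<in> Hom K X Y" and fs: "fs n \<in> Hom K X Y" for n
    by (auto simp: is_lub_def omega_chain_in_def)
  show "is_lub CPO (omap (hom_functor A) X) (omap (hom_functor A) Y)
      (range (\<lambda>n. amap (hom_functor A) (fs n))) (amap (hom_functor A) f)"
    unfolding omap_hom_functor
  proof (rule is_lub_CPO_pointwiseI[OF hom_functor_Hom[OF f]])
    show "range (\<lambda>n. amap (hom_functor A) (fs n)) \<subseteq> Hom CPO (hom_poset A X) (hom_poset A Y)"
      using hom_functor_Hom[OF fs] by auto
    fix s assume s: "s \<in> fst (hom_poset A X)"
    then have "s 0 \<in> Hom K A X" by (simp add: hom_poset_mem)
    from Cmp_lub_left[OF conjunct1[OF *] conjunct2[OF *] this] show "poset_lub (hom_poset A Y) ((\<lambda>f. snd (snd f) s) ` range (\<lambda>n. amap (hom_functor A) (fs n)))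
        (snd (snd (amap (hom_functor A) f)) s)"
      by (simp add: app_hom_functor[OF f s] app_hom_functor[OF fs s] poset_lub_hom_iff image_image)
  qed
qed

lemma locally_continuous_functor_hom:
  "locally_continuous_functor K CPO (hom_functor A)"
  by (intro locally_continuous_functor.intro locally_continuous_functor_axioms.intro
      O_category_axioms O_category_CPO locally_continuous_hom_functor)

text \<open>Evaluation at \<open>Ide K X\<close> recovers an endomorphism from its image, so the
  functor reflects the order as well as preserving it. Endomorphisms suffice, as both clauses of
  local determination concern them.\<close>

lemma hom_functor_reflects_lub:
  assumes lub: "is_lub CPO (hom_poset X X) (hom_poset X X) (range (\<lambda>n. amap (hom_functor X) (fs n)))
      (amap (hom_functor X) f)"
    and f: "f \<in> Hom K X X" and fs: "\<And>n. fs n \<in> Hom K X X"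
  shows "is_lub K X X (range fs) f"
proof -
  have "Ide K X \<in> Hom K X X" using HomD[OF f] Ide_Hom by simp
  then have id: "(\<lambda>_. Ide K X) \<in> fst (hom_poset X X)" by (simp add: hom_poset_mem)
  have le: "g \<sqsubseteq> h" if "amap (hom_functor X) g \<sqsubseteq>\<^bsub>CPO\<^esub> amap (hom_functor X) h"
    "g \<in> Hom K X X" "h \<in> Hom K X X" for g h
    using that(1) id Cmp_Ide_right[OF that(2)] Cmp_Ide_right[OF that(3)]
    unfolding Le_CPO_iff[OF hom_functor_Hom[OF that(2)]]
    by (force simp: app_hom_functor[OF that(2)] app_hom_functor[OF that(3)] hom_poset_le)
  show ?thesis
    unfolding is_lub_def
  proof (intro conjI ballI impI f)
    show "g \<sqsubseteq> f" if "g \<in> range fs" for g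
      using that lub le f fs unfolding is_lub_def by blast
    fix y assume y: "y \<in> Hom K X X" and ub: "\<forall>g \<in> range fs. g \<sqsubseteq> y"
    have "\<forall>g \<in> range (\<lambda>n. amap (hom_functor X) (fs n)). g \<sqsubseteq>\<^bsub>CPO\<^esub> amap (hom_functor X) y"
      using ub hom_functor_mono[OF fs y] by auto
    then show "f \<sqsubseteq> y"
      using lub hom_functor_Hom[OF y] le[OF _ f y] unfolding is_lub_def by blast
  qed
qed

end

section \<open>A locally determined cocone over the represented chain\<close>

context adjoint_chain
begin

text \<open>The comparison \<open>D n \<rightarrow> D k\<close> via ever later stages: the \<open>k\<close>-th component of the
  \<open>n\<close>-th left leg into the limit.\<close>

definition transition :: "nat \<Rightarrow> nat \<Rightarrow> 'm" where
  "transition n k = (SOME t. is_lub K (D n) (D k) (range (\<lambda>i. r k (n + k + i) \<cdot> l n (n + k + i))) t)"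

lemma transition_chain:
  assumes "n \<le> p" "k \<le> p"
  shows "omega_chain_in K (D n) (D k) (\<lambda>i. r k (p + i) \<cdot> l n (p + i))"
  by (rule omega_chain_inI, rule r_l_mono) (use assms in auto)

text \<open>The supremum does not depend on the stage \<open>p\<close> at which the chain starts.\<close>

lemma is_lub_transition:
  assumes p: "n \<le> p" "k \<le> p"
  shows "is_lub K (D n) (D k) (range (\<lambda>i. r k (p + i) \<cdot> l n (p + i))) (transition n k)"
proof (rule is_lub_cofinal)
  have chain: "omega_chain_in K (D n) (D k) (\<lambda>i. r k (n + k + i) \<cdot> l n (n + k + i))"
    by (rule transition_chain) auto
  show "is_lub K (D n) (D k) (range (\<lambda>i. r k (n + k + i) \<cdot> l n (n + k + i))) (transition n k)"
    unfolding transition_def by (rule someI_ex[OF lub_exists[OF chain]])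
  show "range (\<lambda>i. r k (n + k + i) \<cdot> l n (n + k + i)) \<subseteq> Hom K (D n) (D k)"
    by (rule omega_chain_in_Hom[OF chain])
  \<comment> \<open>The chains interleave: stage \<open>n + k + i\<close> of one lies below the term
    of the other with index \<open>n + k + i\<close>, and stage \<open>p + i\<close> below the term
    with index \<open>p + i\<close>.\<close>
  have "hle (D n) (D k) (r k (n + k + i) \<cdot> l n (n + k + i)) (r k (p + (n + k + i)) \<cdot> l n (p + (n + k + i)))"
    "hle (D n) (D k) (r k (p + i) \<cdot> l n (p + i)) (r k (n + k + (p + i)) \<cdot> l n (n + k + (p + i)))" for i
    by (rule r_l_mono; use p in simp)+
  then show "\<exists>g \<in> range (\<lambda>i. r k (p + i) \<cdot> l n (p + i)). hle (D n) (D k) f g"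
    if "f \<in> range (\<lambda>i. r k (n + k + i) \<cdot> l n (n + k + i))" for f
    using that by blast
  show "\<exists>f \<in> range (\<lambda>i. r k (n + k + i) \<cdot> l n (n + k + i)). hle (D n) (D k) g f"
    if "g \<in> range (\<lambda>i. r k (p + i) \<cdot> l n (p + i))" for g
    using that \<open>\<And>i. hle (D n) (D k) (r k (p + i) \<cdot> l n (p + i)) _\<close> by blast
qed

lemma transition_Hom: "transition n k \<in> Hom K (D n) (D k)"
  using is_lub_transition[of n "n + k" k] by (simp add: is_lub_def)

lemmas transition_Arr [simp] = HomD(1-3)[OF transition_Hom]

lemma transition_upper:
  assumes "n \<le> p" "k \<le> p"
  shows "hle (D n) (D k) (r k p \<cdot> l n p) (transition n k)"
  using is_lub_upper[OF is_lub_transition[OF assms] omega_chain_in_Hom[OF transition_chain[OF assms]]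
      rangeI[where x = 0]] by simp

text \<open>Composition with \<open>r k k'\<close> preserves the supremum and collapses each term by
  \<open>r_Cmp\<close>; a starting stage beyond all three indices makes both families equal. Thus
  the components of a left leg form a thread.\<close>

lemma r_transition:
  assumes "k \<le> k'"
  shows "r k k' \<cdot> transition n k' = transition n k"
proof -
  define p where "p = n + k'"
  have p: "n \<le> p" "k \<le> p" "k' \<le> p" using assms by (auto simp: p_def)
  have "r k k' \<cdot> (r k' (p + i) \<cdot> l n (p + i)) = r k (p + i) \<cdot> l n (p + i)" for i
    using p assms by (simp flip: r_Cmp[OF assms, of "p + i"])
  then have "is_lub K (D n) (D k) (range (\<lambda>i. r k (p + i) \<cdot> l n (p + i))) (r k k' \<cdot> transition n k')"
    using Cmp_lub_right[OF r_Hom[OF assms] transition_chain[OF p(1,3)] is_lub_transition[OF p(1,3)]] by simp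
  from is_lub_unique[OF this is_lub_transition[OF p(1,2)]] show ?thesis
    using omega_chain_in_Hom[OF transition_chain[OF p(1,2)]] .
qed

text \<open>The mirror image in the first index; it makes the left legs compatible with the
  chain.\<close>

lemma transition_l:
  assumes "n \<le> m"
  shows "transition m k \<cdot> l n m = transition n k"
proof -
  define p where "p = m + k"
  have p: "n \<le> p" "k \<le> p" "m \<le> p" using assms by (auto simp: p_def)
  have "(r k (p + i) \<cdot> l m (p + i)) \<cdot> l n m = r k (p + i) \<cdot> l n (p + i)" for i
    using p assms by (simp flip: l_Cmp[OF assms, of "p + i"])
  then have "is_lub K (D n) (D k) (range (\<lambda>i. r k (p + i) \<cdot> l n (p + i))) (transition m k \<cdot> l n m)"
    using Cmp_lub_left[OF transition_chain[OF p(3,2)] is_lub_transition[OF p(3,2)] l_Hom[OF assms]]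
    by simp
  from is_lub_unique[OF this is_lub_transition[OF p(1,2)]] show ?thesis
    using omega_chain_in_Hom[OF transition_chain[OF p(1,2)]] .
qed

text \<open>The limit of the posets \<open>Hom K A (D n)\<close> along composition with the right adjoints \<open>r n m\<close>.\<close>

definition thread_poset :: "'o \<Rightarrow> (nat \<Rightarrow> 'm) poset_ob" where
  "thread_poset A = ({x. (\<forall>n. x n \<in> Hom K A (D n)) \<and> (\<forall>n m. n \<le> m \<longrightarrow> r n m \<cdot> x m = x n)},
     \<lambda>x y. \<forall>n. x n \<sqsubseteq> y n)"

lemma thread_poset_mem: "x \<in> fst (thread_poset A) \<longleftrightarrow>
    (\<forall>n. x n \<in> Hom K A (D n)) \<and> (\<forall>n m. n \<le> m \<longrightarrow> r n m \<cdot> x m = x n)"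
  by (simp add: thread_poset_def)

lemma thread_poset_le: "snd (thread_poset A) x y \<longleftrightarrow> (\<forall>n. x n \<sqsubseteq> y n)"
  by (simp add: thread_poset_def)

lemma thread_Hom: "x \<in> fst (thread_poset A) \<Longrightarrow> x n \<in> Hom K A (D n)"
  by (simp add: thread_poset_mem)

lemma thread_chain:
  "poset_chain (thread_poset A) s \<Longrightarrow> omega_chain_in K A (D n) (\<lambda>i. s i n)"
  by (simp add: poset_chain_def omega_chain_in_def thread_poset_mem thread_poset_le)

lemma thread_lubI:
  assumes "x \<in> fst (thread_poset A)" "\<And>n. is_lub K A (D n) (range (\<lambda>i. s i n)) (x n)"
  shows "poset_lub (thread_poset A) (range s) x"
  using assms unfolding poset_lub_def thread_poset_le is_lub_def by (auto simp: thread_poset_mem)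

text \<open>Coordinatewise suprema stay in the limit because composition with \<open>r n m\<close>
  preserves them.\<close>

lemma thread_lub_ex:
  assumes s: "poset_chain (thread_poset A) s"
  shows "\<exists>x \<in> fst (thread_poset A). \<forall>n. is_lub K A (D n) (range (\<lambda>i. s i n)) (x n)"
proof -
  obtain x where x: "\<And>n. is_lub K A (D n) (range (\<lambda>i. s i n)) (x n)"
    using lub_exists[OF thread_chain[OF s]] by metis
  have "r n m \<cdot> x m = x n" if nm: "n \<le> m" for n m
  proof -
    have "r n m \<cdot> s i m = s i n" for i
      using poset_chain_mem[OF s] nm by (simp add: thread_poset_mem)
    then have "is_lub K A (D n) (range (\<lambda>i. s i n)) (r n m \<cdot> x m)"
      using Cmp_lub_right[OF r_Hom[OF nm] thread_chain[OF s] x] by simp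
    from is_lub_unique[OF this x] show ?thesis
      using omega_chain_in_Hom[OF thread_chain[OF s]] .
  qed
  moreover have "x n \<in> Hom K A (D n)" for n using x by (simp add: is_lub_def)
  ultimately have "x \<in> fst (thread_poset A)" by (simp add: thread_poset_mem)
  with x show ?thesis by blast
qed

lemma omega_cpo_thread_poset: "omega_cpo (thread_poset A)"
proof -
  have "reflp_on (fst (thread_poset A)) (snd (thread_poset A))"
    by (rule reflp_onI) (simp add: thread_poset_le reflp_onD[OF Le_refl thread_Hom])
  moreover have "transp_on (fst (thread_poset A)) (snd (thread_poset A))"
    by (rule transp_onI)
      (use transp_onD[OF Le_trans thread_Hom thread_Hom thread_Hom] in \<open>unfold thread_poset_le, blast\<close>)
  moreover have "antisymp_on (fst (thread_poset A)) (snd (thread_poset A))"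
    by (rule antisymp_onI)
      (use antisymp_onD[OF Le_antisym thread_Hom thread_Hom] in
        \<open>unfold thread_poset_le fun_eq_iff, blast\<close>)
  moreover have "\<exists>x. poset_lub (thread_poset A) (range s) x" if s: "poset_chain (thread_poset A) s" for s
    using thread_lub_ex[OF s] thread_lubI by blast
  ultimately show ?thesis by (simp add: omega_cpo_def)
qed

lemma thread_lub_pointwise:
  assumes s: "poset_chain (thread_poset A) s" and x: "poset_lub (thread_poset A) (range s) x"
  shows "is_lub K A (D n) (range (\<lambda>i. s i n)) (x n)"
proof -
  obtain y where y: "y \<in> fst (thread_poset A)" "\<And>n. is_lub K A (D n) (range (\<lambda>i. s i n)) (y n)"
    using thread_lub_ex[OF s] by blast
  have "x = y"
    by (rule poset_lub_unique[OF omega_cpo_thread_poset x thread_lubI[OF y]])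
  then show ?thesis using y(2) by simp
qed

text \<open>The limit-colimit coincidence for adjoint pairs: projections from the limit, with left
  adjoints written down coordinatewise. An arrow, coded as a constant sequence, is read off at
  \<open>0\<close>.\<close>

definition thread_leg :: "'o \<Rightarrow> nat \<Rightarrow> (nat \<Rightarrow> 'm) poset_arr \<times> (nat \<Rightarrow> 'm) poset_arr" where
  "thread_leg A n =
    ((hom_poset A (D n), thread_poset A,
       restrict (\<lambda>s k. transition n k \<cdot> s 0) (fst (hom_poset A (D n)))),
     (thread_poset A, hom_poset A (D n), restrict (\<lambda>x _. x n) (fst (thread_poset A))))"

lemma app_thread_leg:
  "s \<in> fst (hom_poset A (D n)) \<Longrightarrow> snd (snd (fst (thread_leg A n))) s = (\<lambda>k. transition n k \<cdot> s 0)"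
  "x \<in> fst (thread_poset A) \<Longrightarrow> snd (snd (snd (thread_leg A n))) x = (\<lambda>_. x n)"
  by (simp_all add: thread_leg_def)

lemma thread_leg_left_mem:
  assumes "s \<in> fst (hom_poset A (D n))"
  shows "(\<lambda>k. transition n k \<cdot> s 0) \<in> fst (thread_poset A)"
proof -
  have s: "s 0 \<in> Hom K A (D n)" using assms by (simp add: hom_poset_mem)
  have "r k m \<cdot> (transition n m \<cdot> s 0) = transition n k \<cdot> s 0" if "k \<le> m" for k m
    using Cmp_assoc[OF s transition_Hom r_Hom[OF that]] by (simp only: r_transition[OF that])
  then show ?thesis using Cmp_Hom[OF s transition_Hom] by (simp add: thread_poset_mem)
qed

lemma thread_leg_right_mem:
  "x \<in> fst (thread_poset A) \<Longrightarrow> (\<lambda>_. x n) \<in> fst (hom_poset A (D n))"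
  by (simp add: thread_poset_mem hom_poset_mem)

lemma thread_leg_left_Hom: "fst (thread_leg A n) \<in> Hom CPO (hom_poset A (D n)) (thread_poset A)"
proof -
  have "omega_cont (hom_poset A (D n)) (thread_poset A) (\<lambda>s k. transition n k \<cdot> s 0)"
    unfolding omega_cont_def
  proof (intro conjI allI impI ballI funcsetI thread_leg_left_mem)
    show "snd (thread_poset A) (\<lambda>k. transition n k \<cdot> s 0) (\<lambda>k. transition n k \<cdot> t 0)"
      if "s \<in> fst (hom_poset A (D n))" "t \<in> fst (hom_poset A (D n))" "snd (hom_poset A (D n)) s t" for s t
      using that Cmp_mono_right[OF transition_Hom]
      unfolding hom_poset_mem hom_poset_le thread_poset_le by blast
    show "poset_lub (thread_poset A) (range (\<lambda>i k. transition n k \<cdot> s i 0)) (\<lambda>k. transition n k \<cdot> x 0)"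
      if *: "poset_chain (hom_poset A (D n)) s \<and> poset_lub (hom_poset A (D n)) (range s) x" for s x
    proof (rule thread_lubI)
      show "(\<lambda>k. transition n k \<cdot> x 0) \<in> fst (thread_poset A)"
        using * by (intro thread_leg_left_mem) (simp add: poset_lub_def)
      have "is_lub K A (D n) (range (\<lambda>i. s i 0)) (x 0)"
        using * by (simp add: poset_lub_hom_iff image_image)
      then show "is_lub K A (D k) (range (\<lambda>i. transition n k \<cdot> s i 0)) (transition n k \<cdot> x 0)" for k
        by (rule Cmp_lub_right[OF transition_Hom poset_chain_hom[OF conjunct1[OF *]]])
    qed
  qed
  then have "omega_cont (hom_poset A (D n)) (thread_poset A)
      (restrict (\<lambda>s k. transition n k \<cdot> s 0) (fst (hom_poset A (D n))))"
    by (rule omega_cont_cong[rotated]) simp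
  then show ?thesis
    by (simp add: thread_leg_def Hom_CPO omega_cpo_hom_poset omega_cpo_thread_poset)
qed

lemma thread_leg_right_Hom: "snd (thread_leg A n) \<in> Hom CPO (thread_poset A) (hom_poset A (D n))"
proof -
  have "omega_cont (thread_poset A) (hom_poset A (D n)) (\<lambda>x _. x n)"
    unfolding omega_cont_def
    using thread_leg_right_mem thread_lub_pointwise
    by (auto simp: thread_poset_le hom_poset_le poset_lub_hom_iff image_image)
  then have "omega_cont (thread_poset A) (hom_poset A (D n))
      (restrict (\<lambda>x _. x n) (fst (thread_poset A)))"
    by (rule omega_cont_cong[rotated]) simp
  then show ?thesis
    by (simp add: thread_leg_def Hom_CPO omega_cpo_hom_poset omega_cpo_thread_poset)
qed

text \<open>The counit inequality of \<open>thread_leg\<close>. A thread has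
  \<open>x n = r n q \<cdot> x q\<close> at each later stage \<open>q\<close>, which exposes
  \<open>l n q \<cdot> r n q\<close> inside every approximant.\<close>

lemma transition_thread_hle:
  assumes x: "x \<in> fst (thread_poset A)"
  shows "hle A (D k) (transition n k \<cdot> x n) (x k)"
proof -
  define p where "p = n + k"
  have p: "n \<le> p" "k \<le> p" by (auto simp: p_def)
  note xH = thread_Hom[OF x]
  note [simp] = HomD(1-3)[OF xH]
  show ?thesis
  proof (rule is_lub_least[OF Cmp_lub_left[OF transition_chain[OF p] is_lub_transition[OF p] xH] xH], elim rangeE)
    fix f i assume f: "f = (r k (p + i) \<cdot> l n (p + i)) \<cdot> x n"
    have q: "n \<le> p + i" "k \<le> p + i" using p by auto
    have x_r: "x n = r n (p + i) \<cdot> x (p + i)" "x k = r k (p + i) \<cdot> x (p + i)"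
      using x q by (simp_all add: thread_poset_mem)
    have "f = r k (p + i) \<cdot> ((l n (p + i) \<cdot> r n (p + i)) \<cdot> x (p + i))"
      unfolding f x_r(1) using q by simp
    also have "hle A (D k) \<dots> (r k (p + i) \<cdot> x (p + i))"
      using hle_Cmp_right[OF hle_Cmp_left[OF l_r_hle[OF q(1)] xH] r_Hom[OF q(2)]] by simp
    also have "\<dots> = x k" by (rule x_r(2)[symmetric])
    finally show "hle A (D k) f (x k)" .
  qed
qed

text \<open>The unit inequality of \<open>thread_leg\<close>: the stage-\<open>n\<close> approximant
  of \<open>transition n n\<close> is the identity.\<close>

lemma hle_transition:
  assumes f: "f \<in> Hom K A (D n)"
  shows "hle A (D n) f (transition n n \<cdot> f)"
  using hle_Cmp_left[OF transition_upper[of n n n] f] Cmp_Ide_left[OF f] by (simp add: l_r_refl)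

lemma thread_leg_Adj: "thread_leg A n \<in> Hom (Adj CPO) (hom_poset A (D n)) (thread_poset A)"
proof -
  interpret CPO: O_category "CPO :: ((nat \<Rightarrow> 'm) poset_ob, (nat \<Rightarrow> 'm) poset_arr) ocat"
    by (rule O_category_CPO)
  note L = thread_leg_left_Hom[of A n] and R = thread_leg_right_Hom[of A n]
  have Id: "Ide CPO (hom_poset A (D n)) \<in> Hom CPO (hom_poset A (D n)) (hom_poset A (D n))"
    "Ide CPO (thread_poset A) \<in> Hom CPO (thread_poset A) (thread_poset A)"
    by (simp_all add: CPO.Ide_Hom Ob_CPO omega_cpo_hom_poset omega_cpo_thread_poset)
  have "fst (thread_leg A n) \<cdot>\<^bsub>CPO\<^esub> snd (thread_leg A n) \<sqsubseteq>\<^bsub>CPO\<^esub> Ide CPO (thread_poset A)"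
    unfolding Le_CPO_iff[OF CPO.Cmp_Hom[OF R L]]
  proof
    fix x assume x: "x \<in> fst (thread_poset A)"
    show "snd (thread_poset A) (snd (snd (fst (thread_leg A n) \<cdot>\<^bsub>CPO\<^esub> snd (thread_leg A n))) x)
        (snd (snd (Ide CPO (thread_poset A))) x)"
      using transition_thread_hle[OF x]
      by (simp add: app_Cmp_CPO[OF R L x] app_Ide_CPO[OF x] app_thread_leg(2)[OF x]
          app_thread_leg(1)[OF thread_leg_right_mem[OF x]] thread_poset_le hle_def)
  qed
  moreover have "Ide CPO (hom_poset A (D n)) \<sqsubseteq>\<^bsub>CPO\<^esub> snd (thread_leg A n) \<cdot>\<^bsub>CPO\<^esub> fst (thread_leg A n)"
    unfolding Le_CPO_iff[OF Id(1)]
  proof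
    fix s assume s: "s \<in> fst (hom_poset A (D n))"
    then have "s 0 \<in> Hom K A (D n)" by (simp add: hom_poset_mem)
    from hle_transition[OF this]
    show "snd (hom_poset A (D n)) (snd (snd (Ide CPO (hom_poset A (D n)))) s)
        (snd (snd (snd (thread_leg A n) \<cdot>\<^bsub>CPO\<^esub> fst (thread_leg A n))) s)"
      by (simp add: app_Cmp_CPO[OF L R s] app_Ide_CPO[OF s] app_thread_leg(1)[OF s]
          app_thread_leg(2)[OF thread_leg_left_mem[OF s]] hom_poset_le hle_def)
  qed
  ultimately have "(fst (thread_leg A n), snd (thread_leg A n)) \<in> Hom (Adj CPO) (hom_poset A (D n)) (thread_poset A)"
    using L R Id CPO.Cmp_Hom[OF L R] CPO.Cmp_Hom[OF R L] by (intro CPO.AdjI) (simp_all add: CPO.hle_def)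
  then show ?thesis by simp
qed

lemma thread_leg_left_Cmp:
  assumes nm: "n \<le> m"
  shows "fst (thread_leg A m) \<cdot>\<^bsub>CPO\<^esub> amap (hom_functor A) (l n m) = fst (thread_leg A n)"
proof (rule CPO_arr_eqI)
  note L = thread_leg_left_Hom[of A m] and F = hom_functor_Hom[OF l_Hom[OF nm], of A]
  show "fst (thread_leg A m) \<cdot>\<^bsub>CPO\<^esub> amap (hom_functor A) (l n m) \<in> Hom CPO (hom_poset A (D n)) (thread_poset A)"
    by (rule category.Cmp_Hom[OF category_CPO F L])
  show "fst (thread_leg A n) \<in> Hom CPO (hom_poset A (D n)) (thread_poset A)"
    by (rule thread_leg_left_Hom)
  fix s assume s: "s \<in> fst (hom_poset A (D n))"
  then have s0: "s 0 \<in> Hom K A (D n)" by (simp add: hom_poset_mem)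
  then have ls: "(\<lambda>_. l n m \<cdot> s 0) \<in> fst (hom_poset A (D m))"
    using Cmp_Hom[OF _ l_Hom[OF nm]] by (simp add: hom_poset_mem)
  have "transition m k \<cdot> (l n m \<cdot> s 0) = transition n k \<cdot> s 0" for k
    using Cmp_assoc[OF s0 l_Hom[OF nm] transition_Hom] by (simp only: transition_l[OF nm])
  then show "snd (snd (fst (thread_leg A m) \<cdot>\<^bsub>CPO\<^esub> amap (hom_functor A) (l n m))) s
      = snd (snd (fst (thread_leg A n))) s"
    by (simp add: app_Cmp_CPO[OF F L s] app_hom_functor[OF l_Hom[OF nm] s] app_thread_leg(1)[OF s]
        app_thread_leg(1)[OF ls])
qed

lemma thread_leg_right_Cmp:
  assumes nm: "n \<le> m"
  shows "amap (hom_functor A) (r n m) \<cdot>\<^bsub>CPO\<^esub> snd (thread_leg A m) = snd (thread_leg A n)"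
proof (rule CPO_arr_eqI)
  note R = thread_leg_right_Hom[of A m] and F = hom_functor_Hom[OF r_Hom[OF nm], of A]
  show "amap (hom_functor A) (r n m) \<cdot>\<^bsub>CPO\<^esub> snd (thread_leg A m) \<in> Hom CPO (thread_poset A) (hom_poset A (D n))"
    by (rule category.Cmp_Hom[OF category_CPO R F])
  show "snd (thread_leg A n) \<in> Hom CPO (thread_poset A) (hom_poset A (D n))"
    by (rule thread_leg_right_Hom)
  fix x assume x: "x \<in> fst (thread_poset A)"
  then have "r n m \<cdot> x m = x n" using nm by (simp add: thread_poset_mem)
  then show "snd (snd (amap (hom_functor A) (r n m) \<cdot>\<^bsub>CPO\<^esub> snd (thread_leg A m))) x
      = snd (snd (snd (thread_leg A n))) x"
    by (simp add: app_Cmp_CPO[OF R F x] app_thread_leg(2)[OF x]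
        app_hom_functor[OF r_Hom[OF nm] thread_leg_right_mem[OF x]])
qed

lemma omap_func_comp_Adj: "omap (func_comp (Adj_func F) \<Delta>) n = omap F (D n)"
  and amap_func_comp_Adj: "amap (func_comp (Adj_func F) \<Delta>) (n, m) = (amap F (l n m), amap F (r n m))"
  by (simp_all add: func_comp_def Adj_func_def)

lemma adjoint_chain_hom_functor: "adjoint_chain CPO (func_comp (Adj_func (hom_functor A)) \<Delta>)"
  by (rule locally_continuous_functor.adjoint_chain_image[OF locally_continuous_functor_hom
        adjoint_chain_axioms])

lemma adjoint_cocone_thread:
  "adjoint_cocone CPO (func_comp (Adj_func (hom_functor A)) \<Delta>) (thread_poset A) (thread_leg A)"
proof -
  interpret FD: adjoint_chain CPO "func_comp (Adj_func (hom_functor A)) \<Delta>"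
    by (rule adjoint_chain_hom_functor)
  show ?thesis
    by unfold_locales
      (simp add: FD.cocone_iff omap_func_comp_Adj amap_func_comp_Adj omap_hom_functor thread_leg_Adj
        thread_leg_left_Cmp thread_leg_right_Cmp Ob_CPO omega_cpo_thread_poset)
qed

lemma locally_determined_thread:
  "locally_determined CPO (func_comp (Adj_func (hom_functor A)) \<Delta>) (thread_poset A) (thread_leg A)"
proof -
  interpret T: adjoint_cocone CPO "func_comp (Adj_func (hom_functor A)) \<Delta>" "thread_poset A" "thread_leg A"
    by (rule adjoint_cocone_thread)
  note L = thread_leg_left_Hom[of A] and R = thread_leg_right_Hom[of A]
  have Id: "Ide CPO (thread_poset A) \<in> Hom CPO (thread_poset A) (thread_poset A)"
    by (simp add: T.Ide_Hom)
  have "is_lub CPO (thread_poset A) (thread_poset A)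
      (range (\<lambda>n. fst (thread_leg A n) \<cdot>\<^bsub>CPO\<^esub> snd (thread_leg A n))) (Ide CPO (thread_poset A))"
  proof (rule T.is_lubI[OF Id])
    show "T.hle (thread_poset A) (thread_poset A) f (Ide CPO (thread_poset A))"
      if "f \<in> range (\<lambda>n. fst (thread_leg A n) \<cdot>\<^bsub>CPO\<^esub> snd (thread_leg A n))" for f
      using that T.cl_cr_hle by auto
    fix y assume y: "y \<in> Hom CPO (thread_poset A) (thread_poset A)"
      and ub: "\<And>f. f \<in> range (\<lambda>n. fst (thread_leg A n) \<cdot>\<^bsub>CPO\<^esub> snd (thread_leg A n)) \<Longrightarrow>
        T.hle (thread_poset A) (thread_poset A) f y"
    have "Ide CPO (thread_poset A) \<sqsubseteq>\<^bsub>CPO\<^esub> y"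
      unfolding Le_CPO_iff[OF Id]
    proof
      fix x assume x: "x \<in> fst (thread_poset A)"
      \<comment> \<open>Coordinate \<open>n\<close> is settled by the \<open>n\<close>-th leg alone,
        whose value there, \<open>transition n n \<cdot> x n\<close>, already dominates
        \<open>x n\<close>.\<close>
      have "x n \<sqsubseteq> snd (snd y) x n" for n
      proof -
        have yx: "snd (snd y) x \<in> fst (thread_poset A)"
          using omega_cont_mem[OF Hom_CPO_D(4)[OF y] x] .
        have "fst (thread_leg A n) \<cdot>\<^bsub>CPO\<^esub> snd (thread_leg A n) \<sqsubseteq>\<^bsub>CPO\<^esub> y"
          using ub by (simp add: T.hle_def)
        then have "transition n n \<cdot> x n \<sqsubseteq> snd (snd y) x n"
          using x
          by (simp add: Le_CPO_iff[OF T.Cmp_Hom[OF R L]] app_Cmp_CPO[OF R L] app_thread_leg thread_leg_right_mem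
              thread_poset_le)
        then have "hle A (D n) (transition n n \<cdot> x n) (snd (snd y) x n)"
          using Cmp_Hom[OF thread_Hom[OF x] transition_Hom] thread_Hom[OF yx] by (simp add: hle_def)
        from hle_trans[OF hle_transition[OF thread_Hom[OF x]] this] show ?thesis by (simp add: hle_def)
      qed
      then show "snd (thread_poset A) (snd (snd (Ide CPO (thread_poset A))) x) (snd (snd y) x)"
        by (simp add: app_Ide_CPO[OF x] thread_poset_le)
    qed
    then show "T.hle (thread_poset A) (thread_poset A) (Ide CPO (thread_poset A)) y"
      using y Id by (simp add: T.hle_def)
  qed
  moreover have "is_lub CPO (hom_poset A (D n)) (hom_poset A (D n))
      (range (\<lambda>i. amap (hom_functor A) (r n (n + i)) \<cdot>\<^bsub>CPO\<^esub> amap (hom_functor A) (l n (n + i))))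
      (snd (thread_leg A n) \<cdot>\<^bsub>CPO\<^esub> fst (thread_leg A n))" for n
  proof (rule is_lub_CPO_pointwiseI[OF T.Cmp_Hom[OF L R]])
    have Fl: "amap (hom_functor A) (l n (n + i)) \<in> Hom CPO (hom_poset A (D n)) (hom_poset A (D (n + i)))"
      and Fr: "amap (hom_functor A) (r n (n + i)) \<in> Hom CPO (hom_poset A (D (n + i))) (hom_poset A (D n))" for i
      using hom_functor_Hom[OF l_Hom] hom_functor_Hom[OF r_Hom] by simp_all
    show "range (\<lambda>i. amap (hom_functor A) (r n (n + i)) \<cdot>\<^bsub>CPO\<^esub> amap (hom_functor A) (l n (n + i)))
        \<subseteq> Hom CPO (hom_poset A (D n)) (hom_poset A (D n))"
      using T.Cmp_Hom[OF Fl Fr] by auto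
    fix s assume s: "s \<in> fst (hom_poset A (D n))"
    then have s0: "s 0 \<in> Hom K A (D n)" by (simp add: hom_poset_mem)
    note [simp] = HomD(1-3)[OF s0]
    have ls: "(\<lambda>_. l n (n + i) \<cdot> s 0) \<in> fst (hom_poset A (D (n + i)))" for i
      using Cmp_Hom[OF s0 l_Hom] by (simp add: hom_poset_mem)
    \<comment> \<open>Right leg after left leg picks coordinate \<open>n\<close>, that is
      \<open>transition n n \<cdot> s 0\<close>; with stages starting at \<open>n\<close>, its
      supremum has exactly the shape of the second clause.\<close>
    have "is_lub K A (D n) (range (\<lambda>i. r n (n + i) \<cdot> (l n (n + i) \<cdot> s 0))) (transition n n \<cdot> s 0)"
      using Cmp_lub_left[OF transition_chain[of n n n] is_lub_transition[of n n n] s0] by simp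
    then show "poset_lub (hom_poset A (D n))
        ((\<lambda>f. snd (snd f) s) ` range (\<lambda>i. amap (hom_functor A) (r n (n + i)) \<cdot>\<^bsub>CPO\<^esub> amap (hom_functor A) (l n (n + i))))
        (snd (snd (snd (thread_leg A n) \<cdot>\<^bsub>CPO\<^esub> fst (thread_leg A n))) s)"
      by (simp add: poset_lub_hom_iff image_image app_Cmp_CPO[OF L R s] app_Cmp_CPO[OF Fl Fr s]
          app_thread_leg(1)[OF s] app_thread_leg(2)[OF thread_leg_left_mem[OF s]]
          app_hom_functor[OF l_Hom s] app_hom_functor[OF r_Hom ls])
  qed
  ultimately show ?thesis
    unfolding T.locally_determined_iff omap_func_comp_Adj amap_func_comp_Adj omap_hom_functor by simp
qed

section \<open>From preservation back to local determination\<close>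

lemma preserved_imp_locally_determined:
  assumes c: "adjoint_cocone K \<Delta> X c"
    and pres: "\<And>A. preserves_colimit (hom_functor A) CPO \<Delta> X c"
  shows "locally_determined K \<Delta> X c"
proof -
  interpret c: adjoint_cocone K \<Delta> X c by (rule c)
  have "is_lub CPO (hom_poset A X) (hom_poset A X)
        (range (\<lambda>n. amap (hom_functor A) (fst (c n) \<cdot> snd (c n)))) (amap (hom_functor A) (Ide K X))"
    "is_lub CPO (hom_poset A (D n)) (hom_poset A (D n))
        (range (\<lambda>i. amap (hom_functor A) (r n (n + i) \<cdot> l n (n + i))))
        (amap (hom_functor A) (snd (c n) \<cdot> fst (c n)))" for A n
  proof -
    interpret F: locally_continuous_functor K CPO "hom_functor A"
      by (rule locally_continuous_functor_hom)
    interpret T: adjoint_cocone CPO "func_comp (Adj_func (hom_functor A)) \<Delta>" "thread_poset A" "thread_leg A"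
      by (rule adjoint_cocone_thread)
    interpret Fc: adjoint_cocone CPO "func_comp (Adj_func (hom_functor A)) \<Delta>" "hom_poset A X"
        "\<lambda>n. amap (Adj_func (hom_functor A)) (c n)"
      using F.adjoint_cocone_image[OF c] by (simp add: omap_hom_functor)
    \<comment> \<open>Preservation by itself only makes the image cocone colimiting; its suprema are
      imported from the thread cocone, which is colimiting because it is locally determined.\<close>
    have "locally_determined CPO (func_comp (Adj_func (hom_functor A)) \<Delta>) (hom_poset A X)
        (\<lambda>n. amap (Adj_func (hom_functor A)) (c n))"
      by (rule T.colimiting_locally_determined_transfer[OF _
            T.locally_determined_imp_colimiting[OF T.cocone locally_determined_thread]
            locally_determined_thread])
        (use pres[of A] in \<open>simp add: preserves_colimit_def omap_hom_functor\<close>)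
    then show "is_lub CPO (hom_poset A X) (hom_poset A X)
        (range (\<lambda>n. amap (hom_functor A) (fst (c n) \<cdot> snd (c n)))) (amap (hom_functor A) (Ide K X))"
      "is_lub CPO (hom_poset A (D n)) (hom_poset A (D n))
        (range (\<lambda>i. amap (hom_functor A) (r n (n + i) \<cdot> l n (n + i))))
        (amap (hom_functor A) (snd (c n) \<cdot> fst (c n)))"
      unfolding Fc.locally_determined_iff omap_func_comp_Adj amap_func_comp_Adj omap_hom_functor
      by (simp_all add: F.amap_Cmp[OF c.cl_Hom c.cr_Hom] F.amap_Cmp[OF c.cr_Hom c.cl_Hom]
          F.amap_Cmp[OF l_Hom r_Hom] F.amap_Ide omap_hom_functor Adj_func_def)
  qed
  note lub = this
  show ?thesis
    unfolding c.locally_determined_iff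
  proof (intro conjI allI)
    show "is_lub K X X (range (\<lambda>n. fst (c n) \<cdot> snd (c n))) (Ide K X)"
      by (rule hom_functor_reflects_lub[OF lub(1) Ide_Hom[OF c.X_Ob] Cmp_Hom[OF c.cr_Hom c.cl_Hom]])
    show "is_lub K (D n) (D n) (range (\<lambda>i. r n (n + i) \<cdot> l n (n + i))) (snd (c n) \<cdot> fst (c n))" for n
      by (rule hom_functor_reflects_lub[OF lub(2) Cmp_Hom[OF c.cl_Hom c.cr_Hom] Cmp_Hom[OF l_Hom r_Hom]])
        simp_all
  qed
qed

end

theorem mainTheorem3:
  fixes K :: "('o, 'm) ocat"
    and \<Delta> :: "(nat, nat \<times> nat, 'o, 'm \<times> 'm) func"
    and C :: 'o
    and c :: "nat \<Rightarrow> 'm \<times> 'm"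
  assumes "O_category K"
    and "is_functor nat_cat (Adj K) \<Delta>"
    and "colimiting nat_cat (Adj K) \<Delta> C c"
  shows "(locally_determined K \<Delta> C c \<longleftrightarrow>
           (\<forall>(L :: ((nat \<Rightarrow> 'm) poset_ob, (nat \<Rightarrow> 'm) poset_arr) ocat) F.
              O_category L \<and> locally_continuous K L F \<longrightarrow> preserves_colimit F L \<Delta> C c))
       \<and> (locally_determined K \<Delta> C c \<longrightarrow>
           (\<forall>(L :: ('p, 'q) ocat) F.
              O_category L \<and> locally_continuous K L F \<longrightarrow> preserves_colimit F L \<Delta> C c))"
proof -
  interpret O_category K by (fact assms(1))
  interpret adjoint_chain K \<Delta> by unfold_locales (fact assms(2))
  interpret adjoint_cocone K \<Delta> C c
    using assms(3) by unfold_locales (simp add: colimiting_def)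
  \<comment> \<open>\<open>CPO\<close> over sequences of arrows lives at exactly the types of the
    first quantifier over \<open>L\<close>, so the quantifier can be instantiated with it.\<close>
  have bwd: "locally_determined K \<Delta> C c"
    if "\<And>(L :: ((nat \<Rightarrow> 'm) poset_ob, (nat \<Rightarrow> 'm) poset_arr) ocat) F.
        O_category L \<Longrightarrow> locally_continuous K L F \<Longrightarrow> preserves_colimit F L \<Delta> C c"
    by (rule preserved_imp_locally_determined[OF adjoint_cocone_axioms
          that[OF O_category_CPO locally_continuous_hom_functor]])
  \<comment> \<open>The types of \<open>L\<close> stay schematic in this fact, so it serves both
    conjuncts.\<close>
  note fwd = locally_continuous_functor.locally_determined_imp_preserves_colimit
    [OF locally_continuous_functor.intro[OF assms(1) conjunct1
        locally_continuous_functor_axioms.intro[OF conjunct2]] adjoint_cocone_axioms]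
  show ?thesis
    by (intro conjI iffI allI impI bwd) (rule fwd, assumption+ | blast)+
qed

end
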